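(* The center of $PVT_n$ is trivial for every $n \ge 3$, and the center of $VT_n$ is trivial for every $n \ge 2$.
   Context: For $n\ge 2$, the virtual twin group $VT_n$ is the group with generators $s_1,\dots,s_{n-1},\rho_1,\dots,\rho_{n-1}$ and defining relations: $s_i^2=1$ and $\rho_i^2=1$ for $1\le i\le n-1$; $s_is_j=s_js_i$, $\rho_i\rho_j=\rho_j\rho_i$ and $\rho_is_j=s_j\rho_i$ for $|i-j|\ge 2$; $\rho_i\rho_{i+1}\rho_i=\rho_{i+1}\rho_i\rho_{i+1}$ and $\rho_i\rho_{i+1}s_i=s_{i+1}\rho_i\rho_{i+1}$ for $1\le i\le n-2$. The pure virtual twin group $PVT_n$ is the kernel of the surjection $\pi:VT_n\to S_n$, $\pi(s_i)=\pi(\rho_i)=(i,i+1)$. *)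

theory Defs
  imports "HOL-Algebra.Sym_Groups"
begin

section \<open>Groups given by generators and relations\<close>

text \<open>A letter \<open>(a, True)\<close> stands for the generator \<open>a\<close>, and \<open>(a, False)\<close> for its formal inverse.\<close>

type_synonym 'a gword = "('a \<times> bool) list"

abbreviation gwords :: "'a set \<Rightarrow> 'a gword set"
  where "gwords A \<equiv> lists (A \<times> UNIV)"

inductive pres_eq :: "'a set \<Rightarrow> ('a gword \<times> 'a gword) set \<Rightarrow> 'a gword \<Rightarrow> 'a gword \<Rightarrow> bool"
  for A :: "'a set" and R :: "('a gword \<times> 'a gword) set"
  where
    refl: "w \<in> gwords A \<Longrightarrow> pres_eq A R w w"
  | sym: "pres_eq A R u v \<Longrightarrow> pres_eq A R v u"
  | trans: "pres_eq A R u v \<Longrightarrow> pres_eq A R v w \<Longrightarrow> pres_eq A R u w"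
  | app: "pres_eq A R u u' \<Longrightarrow> pres_eq A R v v' \<Longrightarrow> pres_eq A R (u @ v) (u' @ v')"
  | cancel: "a \<in> A \<Longrightarrow> pres_eq A R [(a, b), (a, \<not> b)] []"
  | rel: "(u, v) \<in> R \<Longrightarrow> u \<in> gwords A \<Longrightarrow> v \<in> gwords A \<Longrightarrow> pres_eq A R u v"

definition pres_rel :: "'a set \<Rightarrow> ('a gword \<times> 'a gword) set \<Rightarrow> ('a gword \<times> 'a gword) set"
  where "pres_rel A R = {(u, v). pres_eq A R u v}"

definition presented_group :: "'a set \<Rightarrow> ('a gword \<times> 'a gword) set \<Rightarrow> 'a gword set monoid"
  where "presented_group A R =
    \<lparr> carrier = gwords A // pres_rel A R,
      mult = (\<lambda>X Y. \<Union>u\<in>X. \<Union>v\<in>Y. pres_rel A R `` {u @ v}),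
      one = pres_rel A R `` {[]} \<rparr>"

definition pres_gen :: "'a set \<Rightarrow> ('a gword \<times> 'a gword) set \<Rightarrow> 'a \<Rightarrow> 'a gword set"
  where "pres_gen A R a = pres_rel A R `` {[(a, True)]}"

definition word_eval :: "('b, 'c) monoid_scheme \<Rightarrow> ('a \<Rightarrow> 'b) \<Rightarrow> 'a gword \<Rightarrow> 'b"
  where "word_eval G f w =
    foldr (\<lambda>(a, b) x. (if b then f a else inv\<^bsub>G\<^esub> (f a)) \<otimes>\<^bsub>G\<^esub> x) w \<one>\<^bsub>G\<^esub>"

text \<open>The map out of a presented group induced by a map \<open>f\<close> on its generators; it is meaningful
  whenever \<open>f\<close> respects the relations, since the value then does not depend on the chosen
  representative (see \<open>pres_lift_class\<close> below).\<close>

definition pres_lift :: "('b, 'c) monoid_scheme \<Rightarrow> ('a \<Rightarrow> 'b) \<Rightarrow> 'a gword set \<Rightarrow> 'b"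
  where "pres_lift G f X = word_eval G f (SOME w. w \<in> X)"

lemma pres_eq_words: "pres_eq A R u v \<Longrightarrow> u \<in> gwords A \<and> v \<in> gwords A"
  by (induction rule: pres_eq.induct) auto

lemma equiv_pres_rel: "equiv (gwords A) (pres_rel A R)"
proof (rule equivI)
  show "pres_rel A R \<subseteq> gwords A \<times> gwords A"
    unfolding pres_rel_def using pres_eq_words[of A R] by blast
  show "refl_on (gwords A) (pres_rel A R)"
    unfolding refl_on_def pres_rel_def by (auto intro: pres_eq.refl)
  show "Relation.sym (pres_rel A R)"
    unfolding Relation.sym_def pres_rel_def by (auto intro: pres_eq.sym)
  show "Relation.trans (pres_rel A R)"
    unfolding Relation.trans_def pres_rel_def by (auto intro: pres_eq.trans)
qed

lemma pres_class_eq_iff: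
  "u \<in> gwords A \<Longrightarrow> v \<in> gwords A \<Longrightarrow>
    pres_rel A R `` {u} = pres_rel A R `` {v} \<longleftrightarrow> pres_eq A R u v"
  using eq_equiv_class_iff[OF equiv_pres_rel, of u A v R] by (simp add: pres_rel_def)

lemma presented_group_carrier:
  "X \<in> carrier (presented_group A R) \<longleftrightarrow> (\<exists>w\<in>gwords A. X = pres_rel A R `` {w})"
  by (auto simp: presented_group_def quotient_def)

lemma presented_group_one: "\<one>\<^bsub>presented_group A R\<^esub> = pres_rel A R `` {[]}"
  by (simp add: presented_group_def)

lemma presented_group_mult:
  assumes "u \<in> gwords A" "v \<in> gwords A"
  shows "(pres_rel A R `` {u}) \<otimes>\<^bsub>presented_group A R\<^esub> (pres_rel A R `` {v})
    = pres_rel A R `` {u @ v}"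
proof -
  have *: "pres_rel A R `` {u' @ v'} = pres_rel A R `` {u @ v}"
    if "u' \<in> pres_rel A R `` {u}" "v' \<in> pres_rel A R `` {v}" for u' v'
  proof -
    have "pres_eq A R u u'" "pres_eq A R v v'" using that by (auto simp: pres_rel_def)
    then have "pres_eq A R (u @ v) (u' @ v')" by (rule pres_eq.app)
    then show ?thesis
      using pres_class_eq_iff[of "u @ v" A "u' @ v'" R] pres_eq_words by metis
  qed
  have "u \<in> pres_rel A R `` {u}" "v \<in> pres_rel A R `` {v}"
    using assms by (auto simp: pres_rel_def intro: pres_eq.refl)
  then have "pres_rel A R `` {u} \<noteq> {}" "pres_rel A R `` {v} \<noteq> {}" by blast+
  moreover have "(pres_rel A R `` {u}) \<otimes>\<^bsub>presented_group A R\<^esub> (pres_rel A R `` {v})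
      = (\<Union>u'\<in>pres_rel A R `` {u}. \<Union>v'\<in>pres_rel A R `` {v}. pres_rel A R `` {u @ v})"
    unfolding presented_group_def monoid.simps by (intro SUP_cong HOL.refl *)
  ultimately show ?thesis by (simp only: UN_constant if_False)
qed

lemma pres_eq_inverse_word:
  assumes "w \<in> gwords A"
  shows "pres_eq A R (rev (map (apsnd Not) w) @ w) []"
  using assms
proof (induction w rule: lists.induct)
  case Nil
  then show ?case by (auto intro: pres_eq.refl)
next
  case (Cons x w)
  obtain a b where x: "x = (a, b)" by force
  have a: "a \<in> A" and w: "w \<in> gwords A" using Cons.hyps x by auto
  let ?r = "rev (map (apsnd Not) w)"
  have r: "?r \<in> gwords A" using w by (fastforce simp: in_lists_conv_set)
  have "pres_eq A R [(a, \<not> b), (a, b)] []"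
    using pres_eq.cancel[OF a, of R "\<not> b"] by simp
  then have "pres_eq A R ([(a, \<not> b), (a, b)] @ w) ([] @ w)"
    by (rule pres_eq.app) (rule pres_eq.refl[OF w])
  then have "pres_eq A R (?r @ ([(a, \<not> b), (a, b)] @ w)) (?r @ ([] @ w))"
    by (rule pres_eq.app[OF pres_eq.refl[OF r]])
  then have "pres_eq A R (?r @ ([(a, \<not> b), (a, b)] @ w)) []"
    using Cons.IH by (auto intro: pres_eq.trans)
  then show ?case by (simp add: x)
qed

lemma group_presented_group: "group (presented_group A R)"
proof (rule groupI)
  fix X Y assume "X \<in> carrier (presented_group A R)" "Y \<in> carrier (presented_group A R)"
  then obtain u v where "u \<in> gwords A" "v \<in> gwords A"
      "X = pres_rel A R `` {u}" "Y = pres_rel A R `` {v}"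
    by (auto simp: presented_group_carrier)
  then show "X \<otimes>\<^bsub>presented_group A R\<^esub> Y \<in> carrier (presented_group A R)"
    by (auto simp: presented_group_mult presented_group_carrier intro!: bexI[of _ "u @ v"])
next
  show "\<one>\<^bsub>presented_group A R\<^esub> \<in> carrier (presented_group A R)"
    by (auto simp: presented_group_one presented_group_carrier)
next
  fix X Y Z
  assume "X \<in> carrier (presented_group A R)" "Y \<in> carrier (presented_group A R)"
    "Z \<in> carrier (presented_group A R)"
  then obtain u v w where uvw: "u \<in> gwords A" "v \<in> gwords A" "w \<in> gwords A"
      and "X = pres_rel A R `` {u}" "Y = pres_rel A R `` {v}" "Z = pres_rel A R `` {w}"
    unfolding presented_group_carrier by blast
  moreover have "u @ v \<in> gwords A" "v @ w \<in> gwords A" using uvw by simp_all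
  ultimately show "X \<otimes>\<^bsub>presented_group A R\<^esub> Y \<otimes>\<^bsub>presented_group A R\<^esub> Z =
    X \<otimes>\<^bsub>presented_group A R\<^esub> (Y \<otimes>\<^bsub>presented_group A R\<^esub> Z)"
    by (simp only: presented_group_mult append_assoc)
next
  fix X assume "X \<in> carrier (presented_group A R)"
  then obtain w where w: "w \<in> gwords A" and X: "X = pres_rel A R `` {w}"
    by (auto simp: presented_group_carrier)
  show "\<one>\<^bsub>presented_group A R\<^esub> \<otimes>\<^bsub>presented_group A R\<^esub> X = X"
    using w X presented_group_mult[of "[]" A w R] by (simp add: presented_group_one)
  let ?r = "rev (map (apsnd Not) w)"
  have r: "?r \<in> gwords A" using w by (fastforce simp: in_lists_conv_set)
  have "pres_rel A R `` {?r} \<otimes>\<^bsub>presented_group A R\<^esub> X = \<one>\<^bsub>presented_group A R\<^esub>"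
    using pres_eq_inverse_word[OF w, of R] w r
    by (simp add: X presented_group_mult presented_group_one pres_class_eq_iff)
  moreover have "pres_rel A R `` {?r} \<in> carrier (presented_group A R)"
    using r by (auto simp: presented_group_carrier)
  ultimately show "\<exists>Y\<in>carrier (presented_group A R).
      Y \<otimes>\<^bsub>presented_group A R\<^esub> X = \<one>\<^bsub>presented_group A R\<^esub>"
    by blast
qed

context group
begin

lemma word_eval_closed:
  "f ` A \<subseteq> carrier G \<Longrightarrow> w \<in> gwords A \<Longrightarrow> word_eval G f w \<in> carrier G"
  by (induction w) (auto simp: word_eval_def)

lemma word_eval_append:
  "f ` A \<subseteq> carrier G \<Longrightarrow> u \<in> gwords A \<Longrightarrow> v \<in> gwords A \<Longrightarrow>
    word_eval G f (u @ v) = word_eval G f u \<otimes> word_eval G f v"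
proof (induction u)
  case Nil
  then show ?case using word_eval_closed[of f A v] by (simp add: word_eval_def)
next
  case (Cons x u)
  then show ?case
    using word_eval_closed[of f A u] word_eval_closed[of f A v]
    by (cases x) (auto simp: word_eval_def m_assoc)
qed

lemma word_eval_cong:
  assumes f: "f ` A \<subseteq> carrier G"
    and R: "\<And>u v. (u, v) \<in> R \<Longrightarrow> word_eval G f u = word_eval G f v"
    and "pres_eq A R u v"
  shows "word_eval G f u = word_eval G f v"
  using assms(3)
proof (induction rule: pres_eq.induct)
  case (app u u' v v')
  then show ?case using word_eval_append[OF f] pres_eq_words by metis
next
  case (cancel a b)
  then show ?case using f by (cases b) (auto simp: word_eval_def)
qed (auto simp: R)

lemma pres_lift_class:
  assumes "f ` A \<subseteq> carrier G"
    and "\<And>u v. (u, v) \<in> R \<Longrightarrow> word_eval G f u = word_eval G f v"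
    and "w \<in> gwords A"
  shows "pres_lift G f (pres_rel A R `` {w}) = word_eval G f w"
proof -
  have "w \<in> pres_rel A R `` {w}"
    using assms(3) by (auto simp: pres_rel_def intro: pres_eq.refl)
  then have "(SOME u. u \<in> pres_rel A R `` {w}) \<in> pres_rel A R `` {w}" by (rule someI)
  then have "pres_eq A R w (SOME u. u \<in> pres_rel A R `` {w})" by (simp add: pres_rel_def)
  from word_eval_cong[OF assms(1,2) this] show ?thesis by (simp add: pres_lift_def)
qed

lemma pres_lift_hom:
  assumes "f ` A \<subseteq> carrier G"
    and R: "\<And>u v. (u, v) \<in> R \<Longrightarrow> word_eval G f u = word_eval G f v"
  shows "pres_lift G f \<in> hom (presented_group A R) G"
proof -
  have lift: "pres_lift G f (pres_rel A R `` {w}) = word_eval G f w" if "w \<in> gwords A" for w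
    by (rule pres_lift_class[OF assms(1) _ that]) (rule R)
  show ?thesis
  proof (rule homI)
    fix X assume "X \<in> carrier (presented_group A R)"
    then obtain w where "w \<in> gwords A" "X = pres_rel A R `` {w}"
      unfolding presented_group_carrier by blast
    then show "pres_lift G f X \<in> carrier G"
      by (simp only: lift word_eval_closed[OF assms(1)])
  next
    fix X Y assume "X \<in> carrier (presented_group A R)" "Y \<in> carrier (presented_group A R)"
    then obtain u v where uv: "u \<in> gwords A" "v \<in> gwords A"
        "X = pres_rel A R `` {u}" "Y = pres_rel A R `` {v}"
      unfolding presented_group_carrier by blast
    then have "u @ v \<in> gwords A" by simp
    with uv show "pres_lift G f (X \<otimes>\<^bsub>presented_group A R\<^esub> Y)
        = pres_lift G f X \<otimes> pres_lift G f Y"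
      by (simp only: lift presented_group_mult word_eval_append[OF assms(1)])
  qed
qed

lemma pres_lift_gen:
  assumes "f ` A \<subseteq> carrier G"
    and "\<And>u v. (u, v) \<in> R \<Longrightarrow> word_eval G f u = word_eval G f v"
    and "a \<in> A"
  shows "pres_lift G f (pres_gen A R a) = f a"
proof -
  have "f a \<in> carrier G" using assms by auto
  then show ?thesis
    using pres_lift_class[where A = A and R = R and f = f and w = "[(a, True)]", OF assms(1,2)] assms(3)
    by (simp add: pres_gen_def word_eval_def)
qed

end


section \<open>Virtual twin groups\<close>

datatype vt_gen = SGen nat | RGen nat

definition vt_gens :: "nat \<Rightarrow> vt_gen set"
  where "vt_gens n = SGen ` {1..n - 1} \<union> RGen ` {1..n - 1}"

abbreviation s_letter :: "nat \<Rightarrow> vt_gen \<times> bool"  ("\<s>")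
  where "\<s> i \<equiv> (SGen i, True)"

abbreviation rho_letter :: "nat \<Rightarrow> vt_gen \<times> bool"  ("\<rho>")
  where "\<rho> i \<equiv> (RGen i, True)"

definition vt_rels :: "nat \<Rightarrow> (vt_gen gword \<times> vt_gen gword) set"
  where "vt_rels n =
    {([\<s> i, \<s> i], []) | i. i \<in> {1..n - 1}} \<union>
    {([\<rho> i, \<rho> i], []) | i. i \<in> {1..n - 1}} \<union>
    {([\<s> i, \<s> j], [\<s> j, \<s> i]) | i j.
      i \<in> {1..n - 1} \<and> j \<in> {1..n - 1} \<and> \<bar>int i - int j\<bar> \<ge> 2} \<union>
    {([\<rho> i, \<rho> j], [\<rho> j, \<rho> i]) | i j.
      i \<in> {1..n - 1} \<and> j \<in> {1..n - 1} \<and> \<bar>int i - int j\<bar> \<ge> 2} \<union>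
    {([\<rho> i, \<s> j], [\<s> j, \<rho> i]) | i j.
      i \<in> {1..n - 1} \<and> j \<in> {1..n - 1} \<and> \<bar>int i - int j\<bar> \<ge> 2} \<union>
    {([\<rho> i, \<rho> (i + 1), \<rho> i], [\<rho> (i + 1), \<rho> i, \<rho> (i + 1)]) | i. i \<in> {1..n - 2}} \<union>
    {([\<rho> i, \<rho> (i + 1), \<s> i], [\<s> (i + 1), \<rho> i, \<rho> (i + 1)]) | i. i \<in> {1..n - 2}}"

definition VT :: "nat \<Rightarrow> vt_gen gword set monoid"
  where "VT n = presented_group (vt_gens n) (vt_rels n)"

fun vt_gen_perm :: "vt_gen \<Rightarrow> nat \<Rightarrow> nat"
  where
    "vt_gen_perm (SGen i) = transpose i (i + 1)"
  | "vt_gen_perm (RGen i) = transpose i (i + 1)"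

definition vt_pi :: "nat \<Rightarrow> vt_gen gword set \<Rightarrow> nat \<Rightarrow> nat"
  where "vt_pi n = pres_lift (sym_group n) vt_gen_perm"

definition PVT :: "nat \<Rightarrow> vt_gen gword set monoid"
  where "PVT n = (VT n)\<lparr>carrier := kernel (VT n) (sym_group n) (vt_pi n)\<rparr>"

definition group_center :: "('a, 'b) monoid_scheme \<Rightarrow> 'a set"
  where "group_center G = {z \<in> carrier G. \<forall>x\<in>carrier G. z \<otimes>\<^bsub>G\<^esub> x = x \<otimes>\<^bsub>G\<^esub> z}"

lemma group_VT: "group (VT n)"
  unfolding VT_def by (rule group_presented_group)

lemma vt_gen_perm_closed: "vt_gen_perm ` vt_gens n \<subseteq> carrier (sym_group n)"
  by (auto simp: vt_gens_def sym_group_carrier intro!: permutes_swap_id)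

lemma vt_rels_cases:
  assumes "(u, v) \<in> vt_rels n"
  obtains i where "u = [\<s> i, \<s> i]" "v = []"
    | i where "u = [\<rho> i, \<rho> i]" "v = []"
    | i j where "u = [\<s> i, \<s> j]" "v = [\<s> j, \<s> i]" "\<bar>int i - int j\<bar> \<ge> 2"
    | i j where "u = [\<rho> i, \<rho> j]" "v = [\<rho> j, \<rho> i]" "\<bar>int i - int j\<bar> \<ge> 2"
    | i j where "u = [\<rho> i, \<s> j]" "v = [\<s> j, \<rho> i]" "\<bar>int i - int j\<bar> \<ge> 2"
    | i where "u = [\<rho> i, \<rho> (i + 1), \<rho> i]" "v = [\<rho> (i + 1), \<rho> i, \<rho> (i + 1)]"
    | i where "u = [\<rho> i, \<rho> (i + 1), \<s> i]" "v = [\<s> (i + 1), \<rho> i, \<rho> (i + 1)]"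
  using assms unfolding vt_rels_def Un_iff mem_Collect_eq prod.inject by (elim disjE exE conjE) simp_all

lemma vt_gen_perm_rels:
  assumes "(u, v) \<in> vt_rels n"
  shows "word_eval (sym_group n) vt_gen_perm u = word_eval (sym_group n) vt_gen_perm v"
proof -
  have far: "transpose i (i + 1) \<circ> transpose j (j + 1) = transpose j (j + 1) \<circ> transpose i (i + 1)"
    if "\<bar>int i - int j\<bar> \<ge> 2" for i j :: nat
    using that by (auto simp: fun_eq_iff transpose_def)
  have braid: "transpose i (i + 1) \<circ> (transpose (i + 1) (i + 2) \<circ> transpose i (i + 1)) =
      transpose (i + 1) (i + 2) \<circ> (transpose i (i + 1) \<circ> transpose (i + 1) (i + 2))" for i :: nat
    by (auto simp: fun_eq_iff transpose_def)
  show ?thesis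
    using assms far braid
    by (elim vt_rels_cases) (simp_all add: word_eval_def sym_group_mult sym_group_one)
qed

lemma vt_pi_hom: "vt_pi n \<in> hom (VT n) (sym_group n)"
  unfolding vt_pi_def VT_def
  by (rule group.pres_lift_hom[OF sym_group_is_group vt_gen_perm_closed vt_gen_perm_rels])

lemma vt_pi_gen:
  "g \<in> vt_gens n \<Longrightarrow> vt_pi n (pres_gen (vt_gens n) (vt_rels n) g) = vt_gen_perm g"
  unfolding vt_pi_def
  by (rule group.pres_lift_gen[OF sym_group_is_group vt_gen_perm_closed vt_gen_perm_rels])

lemma pres_gen_closed: "a \<in> A \<Longrightarrow> pres_gen A R a \<in> carrier (presented_group A R)"
  by (auto simp: pres_gen_def presented_group_carrier intro!: bexI[of _ "[(a, True)]"])

lemma vt_pi_surj: "vt_pi n ` carrier (VT n) = carrier (sym_group n)"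
proof -
  interpret group_hom "VT n" "sym_group n" "vt_pi n"
    using group_VT sym_group_is_group vt_pi_hom
    by (simp add: group_hom_def group_hom_axioms_def)
  let ?H = "vt_pi n ` carrier (VT n)"
  have one: "id \<in> ?H"
    using hom_one G.one_closed by (metis image_eqI sym_group_one)
  have mult: "p \<circ> q \<in> ?H" if p: "p \<in> ?H" and q: "q \<in> ?H" for p q
  proof -
    obtain x where x: "p = vt_pi n x" "x \<in> carrier (VT n)" using p by blast
    obtain y where y: "q = vt_pi n y" "y \<in> carrier (VT n)" using q by blast
    have "p \<circ> q = vt_pi n (x \<otimes>\<^bsub>VT n\<^esub> y)"
      using x y by (simp only: hom_mult sym_group_mult)
    then show ?thesis using G.m_closed[OF x(2) y(2)] by (rule image_eqI)
  qed
  have adj: "transpose i (i + 1) \<in> ?H" if "1 \<le> i" "i + 1 \<le> n" for i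
  proof -
    have g: "SGen i \<in> vt_gens n" using that by (auto simp: vt_gens_def)
    have "transpose i (i + 1) = vt_pi n (pres_gen (vt_gens n) (vt_rels n) (SGen i))"
      by (simp only: vt_pi_gen[OF g] vt_gen_perm.simps)
    then show ?thesis
      using pres_gen_closed[OF g, of "vt_rels n"] unfolding VT_def by (rule image_eqI)
  qed
  have less: "transpose i j \<in> ?H" if "1 \<le> i" "i + 1 \<le> j" "j \<le> n" for i j
    using that(2,3)
  proof (induction j rule: dec_induct)
    case base
    then show ?case using adj that(1) by simp
  next
    case (step j)
    have "transpose i (Suc j) = transpose j (j + 1) \<circ> (transpose i j \<circ> transpose j (j + 1))"
      using step.hyps by (auto simp: fun_eq_iff transpose_def)
    moreover have "transpose j (j + 1) \<in> ?H"
      using step.hyps step.prems that(1) by (intro adj) simp_all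
    moreover have "transpose i j \<in> ?H"
      using step.prems by (intro step.IH) simp
    ultimately show ?case by (simp only: mult)
  qed
  have transp: "transpose i j \<in> ?H" if "i \<in> {1..n}" "j \<in> {1..n}" "i \<noteq> j" for i j
    using less[of i j] less[of j i] that
    by (cases "i < j") (auto simp: transpose_commute[of i j])
  have "p \<in> ?H" if "p permutes {1..n}" for p
    using that finite_atLeastAtMost[of 1 n]
  proof (induction rule: permutes_induct)
    case id
    show ?case by (rule one)
  next
    case (swap a b p)
    show ?case by (rule mult[OF transp[OF swap.hyps(1-3)] swap.IH])
  qed
  moreover have "?H \<subseteq> carrier (sym_group n)" by auto
  ultimately show ?thesis by (auto simp: sym_group_carrier)
qed

lemma group_PVT: "group (PVT n)"
proof -
  interpret group_hom "VT n" "sym_group n" "vt_pi n"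
    using group_VT sym_group_is_group vt_pi_hom
    by (simp add: group_hom_def group_hom_axioms_def)
  show ?thesis
    unfolding PVT_def using subgroup_kernel subgroup.subgroup_is_group group_VT by blast
qed

end

theory Submission
  imports Defs
begin

text \<open>
  Write \<open>[i,j]\<close>, for \<open>i \<noteq> j\<close>, for the conjugate of \<open>s\<^sub>1\<close> by any product of the \<open>\<rho>\<^sub>k\<close>
  whose permutation takes \<open>1\<close> to \<open>i\<close> and \<open>2\<close> to \<open>j\<close>; thus \<open>[i,i+1] = s\<^sub>i\<close>. The \<open>\<rho>\<^sub>k\<close>
  satisfy the Coxeter relations of the symmetric group and permute the indices of these involutions,
  and \<open>[i,j]\<close> commutes with \<open>[k,l]\<close> if the two pairs are disjoint. Hence every element of \<open>VT\<^sub>n\<close>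
  has the form \<open>w \<sigma>\<close>, with \<open>w\<close> a reduced word in the letters \<open>[i,j]\<close> (one in which no letter can be
  moved next to an equal one by commutations) and \<open>\<sigma>\<close> a product of \<open>\<rho>\<^sub>k\<close> that is determined by its
  permutation (\<open>normal_form\<close>, \<open>coxeter_unique\<close>). In other words, \<open>VT\<^sub>n\<close> is the semidirect product of
  a right-angled Coxeter group with \<open>S\<^sub>n\<close>.

  That \<open>w\<close> (up to commutations) and \<open>\<sigma>\<close> are unique follows from van der Waerden's trick: \<open>VT\<^sub>n\<close> acts
  on pairs (reduced word, permutation) by its left multiplication on normal forms
  (\<open>word_act_pres_eq\<close>).

  The elements \<open>[i,j] \<rho>\<^sub>i\<^sub>j\<close>, where \<open>\<rho>\<^sub>i\<^sub>j\<close> lies over the transposition \<open>(i j)\<close>, belong to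
  \<open>PVT\<^sub>n\<close>. Let \<open>n \<ge> 3\<close> and let \<open>z = w \<sigma>\<close> commute with all of them. Comparing permutations, \<open>\<sigma>\<close>
  commutes with every transposition, so \<open>\<sigma> = 1\<close>. Comparing words, \<open>a \<tau>(w) = w a\<close> for \<open>a = [i,j]\<close>,
  where \<open>\<tau>\<close> swaps \<open>i\<close> and \<open>j\<close> in all letters; exchanging \<open>i\<close> and \<open>j\<close> if
  necessary, no cancellation takes place in \<open>a \<tau>(w)\<close>. If \<open>w\<close> contained a letter \<open>[i,l]\<close>, choose \<open>j\<close>
  different from \<open>i\<close> and \<open>l\<close>. No two of \<open>[i,j]\<close>, \<open>[j,i]\<close>, \<open>[i,l]\<close>, \<open>[j,l]\<close> are disjoint,
  so the order in which these four letters occur is an invariant of commutation. The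
  equation for the subword \<open>u\<close> of \<open>w\<close> formed by them is therefore an equation between lists, and it
  forces \<open>u\<close> to be \<open>a \<tau>(a) a \<tau>(a) \<dots>\<close>, which does not contain \<open>[i,l]\<close>. So \<open>w\<close> is
  empty, which settles both groups for \<open>n \<ge> 3\<close> at once (\<open>centralizer_PVT_trivial\<close>). For \<open>n = 2\<close> the
  reduced word is literally invariant under the swap of \<open>1\<close> and \<open>2\<close>, which has no fixed letter
  (\<open>center_VT2_trivial\<close>).
\<close>

section \<open>Reduced words in a right-angled Coxeter group\<close>

text \<open>The letters are involutions, and \<open>D a b\<close> means that \<open>a\<close> and \<open>b\<close> need not commute; in
  particular letters are dependent on themselves.\<close>

locale dependence =
  fixes D :: "'a \<Rightarrow> 'a \<Rightarrow> bool"
  assumes D_refl: "D a a" and D_sym: "D a b \<Longrightarrow> D b a"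
begin

definition clique :: "'a set \<Rightarrow> bool"
  where "clique C \<longleftrightarrow> (\<forall>a\<in>C. \<forall>b\<in>C. D a b)"

text \<open>Equality of words up to commutation of independent letters. Instead of generating it by swaps,
  the relation is described by a complete set of invariants: the subwords on the sets of pairwise
  dependent letters. These subwords can be compared as lists, and left multiplication by a letter
  changes each of them at most at its head.\<close>
definition teq :: "'a list \<Rightarrow> 'a list \<Rightarrow> bool"
  where "teq v w \<longleftrightarrow> (\<forall>C. clique C \<longrightarrow> filter (\<lambda>c. c \<in> C) v = filter (\<lambda>c. c \<in> C) w)"

text \<open>The letter \<open>a\<close> can be moved to the front of the word.\<close>
primrec front :: "'a \<Rightarrow> 'a list \<Rightarrow> bool" where
  "front a [] \<longleftrightarrow> False"
| "front a (c # w) \<longleftrightarrow> c = a \<or> \<not> D a c \<and> front a w"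

primrec reduced :: "'a list \<Rightarrow> bool" where
  "reduced [] \<longleftrightarrow> True"
| "reduced (a # w) \<longleftrightarrow> \<not> front a w \<and> reduced w"

text \<open>Left multiplication by an involution on reduced words.\<close>
definition act :: "'a \<Rightarrow> 'a list \<Rightarrow> 'a list"
  where "act a w = (if front a w then remove1 a w else a # w)"

lemma teq_refl [simp]: "teq w w"
  and teq_sym: "teq v w \<Longrightarrow> teq w v"
  and teq_trans: "teq u v \<Longrightarrow> teq v w \<Longrightarrow> teq u w"
  by (simp_all add: teq_def)

lemma teq_filter: "teq v w \<Longrightarrow> clique C \<Longrightarrow> filter (\<lambda>c. c \<in> C) v = filter (\<lambda>c. c \<in> C) w"
  by (simp add: teq_def)

lemma clique_pair: "D a b \<Longrightarrow> clique {a, b}"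
  using D_refl D_sym by (auto simp: clique_def)

lemma teq_length:
  assumes "teq v w"
  shows "length v = length w"
proof -
  have "count (mset v) a = count (mset w) a" for a
  proof -
    have "filter ((=) a) v = filter ((=) a) w"
      using teq_filter[OF assms clique_pair[OF D_refl], of a] by (simp add: eq_commute[of _ a])
    then show ?thesis by (simp add: count_mset count_list_eq_length_filter)
  qed
  then have "mset v = mset w" by (rule multiset_eqI)
  then show ?thesis by (metis size_mset)
qed

lemma front_filter:
  "front a w \<Longrightarrow> clique C \<Longrightarrow> a \<in> C \<Longrightarrow>
    filter (\<lambda>c. c \<in> C) w = a # filter (\<lambda>c. c \<in> C) (remove1 a w)"
  by (induction w) (auto simp: clique_def)

text \<open>Being movable to the front is thus an invariant of words up to commutation. Conversely to
  \<open>front_filter\<close>, a dependent letter \<open>x\<close> in front of the first \<open>a\<close> would be the head of the subword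
  on \<open>{a, x}\<close>.\<close>
lemma front_iff:
  "front a w \<longleftrightarrow> (\<forall>C. clique C \<longrightarrow> a \<in> C \<longrightarrow> (\<exists>q. filter (\<lambda>c. c \<in> C) w = a # q))"
proof
  assume "\<forall>C. clique C \<longrightarrow> a \<in> C \<longrightarrow> (\<exists>q. filter (\<lambda>c. c \<in> C) w = a # q)"
  then show "front a w"
  proof (induction w)
    case Nil
    then show ?case using clique_pair[OF D_refl, of a] by auto
  next
    case (Cons x w)
    show ?case
    proof (cases "x = a")
      case False
      then have x: "\<not> D a x"
        using Cons.prems clique_pair[of a x] by auto
      have "\<exists>q. filter (\<lambda>c. c \<in> C) w = a # q" if C: "clique C" "a \<in> C" for C
      proof -
        have "x \<notin> C" using x C by (auto simp: clique_def)
        then show ?thesis using Cons.prems C by auto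
      qed
      then show ?thesis using Cons.IH x by simp
    qed simp
  qed
qed (blast dest: front_filter)

lemma front_teq: "teq v w \<Longrightarrow> front a v \<longleftrightarrow> front a w"
  unfolding front_iff teq_def by metis

lemma filter_remove1_notin: "\<not> P a \<Longrightarrow> filter P (remove1 a w) = filter P w"
  by (induction w) auto

lemma filter_act:
  assumes "clique C"
  shows "filter (\<lambda>c. c \<in> C) (act a w) =
    (if a \<in> C then if front a w then tl (filter (\<lambda>c. c \<in> C) w) else a # filter (\<lambda>c. c \<in> C) w
     else filter (\<lambda>c. c \<in> C) w)"
  using front_filter[of a w C] assms by (simp add: act_def filter_remove1_notin)

lemma act_teq: "teq v w \<Longrightarrow> teq (act a v) (act a w)"
  using front_teq[of v w a] unfolding teq_def by (simp add: filter_act)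

lemma front_act:
  assumes "\<not> D a b"
  shows "front a (act b w) \<longleftrightarrow> front a w"
proof -
  have "filter (\<lambda>c. c \<in> C) (act b w) = filter (\<lambda>c. c \<in> C) w" if "clique C" "a \<in> C" for C
    using that assms by (subst filter_act) (auto simp: clique_def)
  then show ?thesis unfolding front_iff by simp
qed

text \<open>No clique contains two independent letters, so their actions change different subwords and do
  not influence each other's case distinction.\<close>
lemma act_commute:
  assumes "\<not> D a b"
  shows "teq (act a (act b w)) (act b (act a w))"
  unfolding teq_def
proof (intro allI impI)
  fix C assume C: "clique C"
  have ba: "\<not> D b a" using assms D_sym by blast
  have "a \<notin> C \<or> b \<notin> C" using C assms by (auto simp: clique_def)
  then show "filter (\<lambda>c. c \<in> C) (act a (act b w)) = filter (\<lambda>c. c \<in> C) (act b (act a w))"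
    using C by (auto simp: filter_act front_act[OF assms] front_act[OF ba])
qed

lemma front_remove1: "x \<noteq> a \<Longrightarrow> \<not> D x a \<Longrightarrow> front x (remove1 a w) \<longleftrightarrow> front x w"
  by (induction w) auto

lemma reduced_remove1:
  "reduced w \<Longrightarrow> front a w \<Longrightarrow> reduced (remove1 a w) \<and> \<not> front a (remove1 a w)"
proof (induction w)
  case (Cons x w)
  then show ?case
    using front_remove1[of x a w] D_sym[of x a] by auto
qed simp

lemma reduced_act: "reduced w \<Longrightarrow> reduced (act a w)"
  using reduced_remove1[of w a] by (simp add: act_def)

text \<open>Reducedness is essential here: on a word such as \<open>[a, a]\<close> two
  successive applications of \<open>a\<close> would both cancel.\<close>
lemma act_act:
  assumes "reduced w"
  shows "teq (act a (act a w)) w"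
proof (cases "front a w")
  case True
  then have "\<not> front a (remove1 a w)" using reduced_remove1 assms by blast
  then have eq: "act a (act a w) = a # remove1 a w" using True by (simp add: act_def)
  show ?thesis unfolding eq teq_def
    using front_filter[OF True] filter_remove1_notin[of _ a w] by auto
qed (simp add: act_def)

lemma foldr_act_reduced: "reduced w \<Longrightarrow> foldr act w [] = w"
  by (induction w) (auto simp: act_def)

lemma length_act: "length (act a w) \<le> Suc (length w)"
  by (auto simp: act_def length_remove1)

lemma length_foldr_act: "length (foldr act w []) \<le> length w"
proof (induction w)
  case (Cons a w)
  then show ?case using length_act[of a "foldr act w []"] by simp
qed simp

text \<open>This detects reduced words by length alone: multiplying the letters together must never have
  cancelled anything.\<close>
lemma foldr_act_eq:
  "length (foldr act w []) = length w \<Longrightarrow> foldr act w [] = w"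
proof (induction w)
  case (Cons a w)
  let ?v = "foldr act w []"
  have "length ?v = length w"
    using Cons.prems length_act[of a ?v] length_foldr_act[of w] by simp
  then have v: "?v = w" by (rule Cons.IH)
  then have "length (act a w) = Suc (length w)" using Cons.prems by simp
  then have "\<not> front a w" by (auto simp: act_def length_remove1 split: if_splits)
  then have "act a w = a # w" by (simp add: act_def)
  then show ?case using v by simp
qed simp

end

text \<open>Relabellings of the letters that respect dependence commute with the whole construction; the
  \<open>\<rho>\<^sub>i\<close> act in this way.\<close>
locale dependence_automorphism = dependence +
  fixes f :: "'a \<Rightarrow> 'a"
  assumes bij: "bij f" and D_iff: "D (f a) (f b) \<longleftrightarrow> D a b"
begin

lemma front_map: "front (f a) (map f w) \<longleftrightarrow> front a w"
  using bij_is_inj[OF bij] by (induction w) (auto simp: D_iff inj_eq)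

lemma act_map: "act (f a) (map f w) = map f (act a w)"
proof -
  have "remove1 (f a) (map f w) = map f (remove1 a w)"
    using bij_is_inj[OF bij] by (induction w) (auto simp: inj_eq)
  then show ?thesis by (simp add: act_def front_map)
qed

lemma reduced_map: "reduced (map f w) \<longleftrightarrow> reduced w"
  by (induction w) (auto simp: front_map)

lemma teq_map:
  assumes "teq v w"
  shows "teq (map f v) (map f w)"
  unfolding teq_def
proof (intro allI impI)
  fix C assume "clique C"
  then have C: "clique (f -` C)" unfolding clique_def using D_iff by blast
  have "filter (\<lambda>c. c \<in> C) (map f u) = map f (filter (\<lambda>c. c \<in> f -` C) u)" for u
    by (simp add: filter_map o_def)
  then show "filter (\<lambda>c. c \<in> C) (map f v) = filter (\<lambda>c. c \<in> C) (map f w)"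
    using teq_filter[OF assms C] by simp
qed

end

text \<open>Reading the equation position by position, the letters of \<open>u\<close> are \<open>a\<close>, \<open>t a\<close>,
  \<open>t (t a)\<close>, and so on.\<close>
lemma twisted_rotation:
  assumes eq: "a # map t u = u @ [a]" and t: "t ` {a, b} \<subseteq> {a, b}"
  shows "set u \<subseteq> {a, b}"
proof -
  have "u ! k \<in> {a, b}" if "k < length u" for k
    using that
  proof (induction k)
    case 0
    then show ?case using arg_cong[OF eq, of "\<lambda>x. x ! 0"] by (simp add: nth_append)
  next
    case (Suc k)
    then have "u ! Suc k = t (u ! k)"
      using arg_cong[OF eq, of "\<lambda>x. x ! Suc k"] by (simp add: nth_append)
    then show ?case using Suc t by auto
  qed
  then show ?thesis unfolding in_set_conv_nth subset_iff by blast
qed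

context dependence_automorphism
begin

text \<open>The two equivalences express \<open>a f(w) = w a\<close> and \<open>f(a) f(w) = w f(a)\<close> in
  the Coxeter group. Having both equations avoids any analysis of cancellation at the right end of \<open>w a\<close>: since
  \<open>a\<close> and \<open>f a\<close> are distinct and dependent, they are not both movable to the front of \<open>f(w)\<close>, and
  for one of them the left-hand side is reduced. By length the right-hand side is then reduced too, and
  the two sides have equal subwords on the clique \<open>C\<close>.\<close>
lemma twisted_commuting_word:
  assumes w: "reduced w"
    and inv: "f (f a) = a"
    and a: "teq (act a (map f w)) (foldr act (w @ [a]) [])"
    and b: "teq (act (f a) (map f w)) (foldr act (w @ [f a]) [])"
    and ne: "f a \<noteq> a"
    and C: "clique C" "f -` C = C" "a \<in> C"
  shows "set w \<inter> C \<subseteq> {a, f a}"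
proof -
  have *: "set w \<inter> C \<subseteq> {a, f a}"
    if nf: "\<not> front c (map f w)" and c: "c \<in> {a, f a}"
      and eq: "teq (act c (map f w)) (foldr act (w @ [c]) [])" for c
  proof -
    have eq': "teq (c # map f w) (foldr act (w @ [c]) [])"
      using nf eq by (simp add: act_def)
    have "length (foldr act (w @ [c]) []) = length (w @ [c])"
      using teq_length[OF eq'] by simp
    then have "foldr act (w @ [c]) [] = w @ [c]" by (rule foldr_act_eq)
    then have "filter (\<lambda>x. x \<in> C) (c # map f w) = filter (\<lambda>x. x \<in> C) (w @ [c])"
      using teq_filter[OF eq' C(1)] by simp
    moreover have "c \<in> C" using c C by auto
    moreover have "filter (\<lambda>x. x \<in> C) (map f w) = map f (filter (\<lambda>x. x \<in> C) w)"
      using C(2) by (simp add: filter_map o_def set_eq_iff)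
    ultimately have "c # map f (filter (\<lambda>x. x \<in> C) w) = filter (\<lambda>x. x \<in> C) w @ [c]"
      by simp
    then have "set (filter (\<lambda>x. x \<in> C) w) \<subseteq> {c, f c}"
      by (rule twisted_rotation) (use c inv in auto)
    then show ?thesis using c inv by auto
  qed
  have "f a \<in> C" using C by auto
  then have "\<not> front a (map f w) \<or> \<not> front (f a) (map f w)"
    using front_filter[of _ "map f w" C] C ne by (metis list.inject)
  then show ?thesis using *[of a] *[of "f a"] a b by blast
qed

end

section \<open>The action of the virtual twin group\<close>

text \<open>The letter \<open>[i,j]\<close> is the pair \<open>(i, j)\<close>. Letters that share an index are dependent.\<close>
definition meets :: "nat \<times> nat \<Rightarrow> nat \<times> nat \<Rightarrow> bool"
  where "meets a b \<longleftrightarrow> {fst a, snd a} \<inter> {fst b, snd b} \<noteq> {}"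

interpretation pair: dependence meets
  by unfold_locales (auto simp: meets_def)

lemma pair_automorphism:
  assumes "bij p"
  shows "dependence_automorphism meets (map_prod p p)"
proof unfold_locales
  have p: "p x = p y \<longleftrightarrow> x = y" for x y using bij_is_inj[OF assms] by (simp add: inj_eq)
  show "bij (map_prod p p)" using assms bij_betw_map_prod[of p UNIV UNIV p UNIV UNIV] by simp
  show "meets (map_prod p p a) (map_prod p p b) \<longleftrightarrow> meets a b" for a b
    by (auto simp: meets_def p)
qed

lemma transpose_automorphism: "dependence_automorphism meets (map_prod (transpose i j) (transpose i j))"
  by (rule pair_automorphism) simp

abbreviation relabel :: "(nat \<Rightarrow> nat) \<Rightarrow> (nat \<times> nat) list \<Rightarrow> (nat \<times> nat) list"
  where "relabel p \<equiv> map (map_prod p p)"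

text \<open>Left multiplication by a generator on normal forms \<open>w \<sigma>\<close>.\<close>
fun gen_act :: "vt_gen \<Rightarrow> (nat \<times> nat) list \<times> (nat \<Rightarrow> nat) \<Rightarrow> (nat \<times> nat) list \<times> (nat \<Rightarrow> nat)" where
  "gen_act (SGen i) (w, p) = (pair.act (i, i + 1) w, p)"
| "gen_act (RGen i) (w, p) = (relabel (transpose i (i + 1)) w, transpose i (i + 1) \<circ> p)"

definition word_act :: "vt_gen list \<Rightarrow> (nat \<times> nat) list \<times> (nat \<Rightarrow> nat) \<Rightarrow> (nat \<times> nat) list \<times> (nat \<Rightarrow> nat)"
  where "word_act = foldr gen_act"

definition state_eq :: "(nat \<times> nat) list \<times> (nat \<Rightarrow> nat) \<Rightarrow> (nat \<times> nat) list \<times> (nat \<Rightarrow> nat) \<Rightarrow> bool"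
  where "state_eq x y \<longleftrightarrow> pair.teq (fst x) (fst y) \<and> snd x = snd y"

lemma word_act_Nil [simp]: "word_act [] x = x"
  and word_act_Cons [simp]: "word_act (g # u) x = gen_act g (word_act u x)"
  and word_act_append [simp]: "word_act (u @ v) x = word_act u (word_act v x)"
  by (simp_all add: word_act_def)

lemma state_eq_refl [simp]: "state_eq x x"
  and state_eq_sym: "state_eq x y \<Longrightarrow> state_eq y x"
  and state_eq_trans: "state_eq x y \<Longrightarrow> state_eq y z \<Longrightarrow> state_eq x z"
  by (auto simp: state_eq_def intro: pair.teq_sym pair.teq_trans)

lemma gen_act_reduced: "pair.reduced (fst x) \<Longrightarrow> pair.reduced (fst (gen_act g x))"
  using dependence_automorphism.reduced_map[OF transpose_automorphism]
  by (cases "(g, x)" rule: gen_act.cases) (auto intro: pair.reduced_act)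

lemma word_act_reduced: "pair.reduced (fst x) \<Longrightarrow> pair.reduced (fst (word_act u x))"
  by (induction u) (auto intro: gen_act_reduced)

lemma gen_act_cong: "state_eq x y \<Longrightarrow> state_eq (gen_act g x) (gen_act g y)"
  using dependence_automorphism.teq_map[OF transpose_automorphism]
  by (cases x; cases y; cases g) (auto simp: state_eq_def intro: pair.act_teq)

lemma word_act_cong: "state_eq x y \<Longrightarrow> state_eq (word_act u x) (word_act u y)"
  by (induction u) (auto intro: gen_act_cong)

lemma relabel_comp: "relabel p (relabel q w) = relabel (p \<circ> q) w"
  by (simp add: map_prod_def split_def)

text \<open>The relation \<open>s\<^sub>i\<^sup>2 = 1\<close> holds because \<open>w\<close> is reduced, far commutation because the
  letters are disjoint, and the relations involving \<open>\<rho>\<^sub>i\<close> because relabelling is compatible with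
  \<open>act\<close>.\<close>
lemma word_act_rel:
  assumes "(u, v) \<in> vt_rels n" "pair.reduced w"
  shows "state_eq (word_act (map fst u) (w, p)) (word_act (map fst v) (w, p))"
proof -
  have inv: "transpose i j \<circ> transpose i j = id" for i j :: nat
    by (auto simp: fun_eq_iff)
  have far: "transpose i (i + 1) \<circ> transpose j (j + 1) = transpose j (j + 1) \<circ> transpose i (i + 1)"
    if "\<bar>int i - int j\<bar> \<ge> 2" for i j :: nat
    using that by (auto simp: fun_eq_iff transpose_def)
  have braid: "transpose i (i + 1) \<circ> (transpose (i + 1) (i + 2) \<circ> transpose i (i + 1)) =
      transpose (i + 1) (i + 2) \<circ> (transpose i (i + 1) \<circ> transpose (i + 1) (i + 2))" for i :: nat
    by (auto simp: fun_eq_iff transpose_def)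
  have act: "relabel (transpose i j) (pair.act (k, l) w) =
      pair.act (transpose i j k, transpose i j l) (relabel (transpose i j) w)" for i j k l w
    using dependence_automorphism.act_map[OF transpose_automorphism, of i j "(k, l)" w] by simp
  from assms(1) show ?thesis
  proof (cases rule: vt_rels_cases)
    case (1 i)
    then show ?thesis using pair.act_act[OF assms(2)] by (simp add: state_eq_def)
  next
    case (2 i)
    then show ?thesis
      by (simp add: relabel_comp inv o_assoc del: map_map) (simp add: prod.map_id0)
  next
    case (3 i j)
    then have "\<not> meets (i, i + 1) (j, j + 1)" by (auto simp: meets_def)
    from pair.act_commute[OF this] show ?thesis using 3 by (simp add: state_eq_def)
  next
    case (4 i j)
    then show ?thesis using far[of i j] by (simp add: relabel_comp o_assoc del: map_map)
  next
    case (5 i j)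
    then have "transpose i (i + 1) j = j" "transpose i (i + 1) (j + 1) = j + 1"
      by (auto simp: transpose_def)
    then show ?thesis using 5 by (simp add: act)
  next
    case (6 i)
    then show ?thesis using braid[of i] by (simp add: relabel_comp o_assoc del: map_map)
  next
    case (7 i)
    have "transpose i (i + 1) (transpose (i + 1) (i + 2) i) = i + 1"
      "transpose i (i + 1) (transpose (i + 1) (i + 2) (i + 1)) = i + 2"
      by (auto simp: transpose_def)
    then show ?thesis using 7 by (simp add: act)
  qed
qed

lemma word_act_pres_eq:
  assumes "pres_eq (vt_gens n) (vt_rels n) u v" and "pair.reduced (fst x)"
  shows "state_eq (word_act (map fst u) x) (word_act (map fst v) x)"
  using assms
proof (induction arbitrary: x rule: pres_eq.induct)
  case (refl w)
  show ?case by simp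
next
  case (sym u v)
  then show ?case using state_eq_sym by blast
next
  case (trans u v w)
  then show ?case using state_eq_trans by blast
next
  case (app u u' v v')
  have "state_eq (word_act (map fst u) (word_act (map fst v) x))
      (word_act (map fst u) (word_act (map fst v') x))"
    using app by (blast intro: word_act_cong)
  moreover have "state_eq (word_act (map fst u) (word_act (map fst v') x))
      (word_act (map fst u') (word_act (map fst v') x))"
    using app by (blast intro: word_act_reduced)
  ultimately show ?case by (auto intro: state_eq_trans)
next
  case (cancel a b)
  have "([(a, True), (a, True)], []) \<in> vt_rels n"
    using cancel(1) by (cases a) (auto simp: vt_rels_def vt_gens_def)
  from word_act_rel[OF this, of "fst x" "snd x"] show ?case using cancel by simp
next
  case (rel u v)
  then show ?case using word_act_rel[of u v n "fst x" "snd x"] by simp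
qed

section \<open>Positive words as elements of the group\<close>

text \<open>As all generators are involutions, words without formal inverses suffice. Working with lists of
  generators makes associativity automatic.\<close>
definition cls :: "nat \<Rightarrow> vt_gen list \<Rightarrow> vt_gen gword set"
  where "cls n u = pres_rel (vt_gens n) (vt_rels n) `` {map (\<lambda>g. (g, True)) u}"

lemma gwords_map_iff: "map (\<lambda>g. (g, True)) u \<in> gwords A \<longleftrightarrow> set u \<subseteq> A"
  by (auto simp: in_lists_conv_set)

lemma cls_mult:
  "set u \<subseteq> vt_gens n \<Longrightarrow> set v \<subseteq> vt_gens n \<Longrightarrow> cls n u \<otimes>\<^bsub>VT n\<^esub> cls n v = cls n (u @ v)"
  unfolding cls_def VT_def by (simp add: presented_group_mult gwords_map_iff)

lemma cls_closed: "set u \<subseteq> vt_gens n \<Longrightarrow> cls n u \<in> carrier (VT n)"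
  unfolding cls_def VT_def presented_group_carrier gwords_map_iff[symmetric] by blast

lemma cls_one: "\<one>\<^bsub>VT n\<^esub> = cls n []"
  by (simp add: cls_def VT_def presented_group_one)

lemma cls_eq_iff:
  "set u \<subseteq> vt_gens n \<Longrightarrow> set v \<subseteq> vt_gens n \<Longrightarrow> cls n u = cls n v \<longleftrightarrow>
    pres_eq (vt_gens n) (vt_rels n) (map (\<lambda>g. (g, True)) u) (map (\<lambda>g. (g, True)) v)"
  unfolding cls_def by (rule pres_class_eq_iff) (simp_all only: gwords_map_iff)

text \<open>Words with a letter outside the generating set have an empty class. This convention makes
  \<open>cls_append_cong\<close> and \<open>cls_cong\<close> valid without side conditions, so that subwords can be rewritten
  freely.\<close>
lemma cls_empty_iff: "cls n u = {} \<longleftrightarrow> \<not> set u \<subseteq> vt_gens n"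
proof
  assume empty: "cls n u = {}"
  show "\<not> set u \<subseteq> vt_gens n"
  proof
    assume "set u \<subseteq> vt_gens n"
    then have "pres_eq (vt_gens n) (vt_rels n) (map (\<lambda>g. (g, True)) u) (map (\<lambda>g. (g, True)) u)"
      unfolding gwords_map_iff[symmetric] by (rule pres_eq.refl)
    then show False using empty by (auto simp: cls_def pres_rel_def)
  qed
next
  assume "\<not> set u \<subseteq> vt_gens n"
  then show "cls n u = {}"
    unfolding gwords_map_iff[symmetric]
    by (auto simp: cls_def pres_rel_def dest: pres_eq_words)
qed

lemma cls_append_cong:
  assumes "cls n u = cls n u'" "cls n v = cls n v'"
  shows "cls n (u @ v) = cls n (u' @ v')"
proof (cases "set u \<subseteq> vt_gens n \<and> set v \<subseteq> vt_gens n")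
  case True
  then have "set u' \<subseteq> vt_gens n" "set v' \<subseteq> vt_gens n" using assms cls_empty_iff by metis+
  then show ?thesis using True assms cls_mult by metis
next
  case False
  then have "\<not> (set u' \<subseteq> vt_gens n \<and> set v' \<subseteq> vt_gens n)" using assms cls_empty_iff by metis
  then have "cls n (u @ v) = {}" "cls n (u' @ v') = {}"
    unfolding cls_empty_iff using False by auto
  then show ?thesis by simp
qed

lemma cls_cong: "cls n u = cls n u' \<Longrightarrow> cls n (p @ u @ q) = cls n (p @ u' @ q)"
  by (intro cls_append_cong HOL.refl)

lemma cls_rel:
  "(map (\<lambda>g. (g, True)) u, map (\<lambda>g. (g, True)) v) \<in> vt_rels n \<Longrightarrow>
    set u \<subseteq> vt_gens n \<Longrightarrow> set v \<subseteq> vt_gens n \<Longrightarrow> cls n u = cls n v"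
  by (subst cls_eq_iff) (auto intro!: pres_eq.rel simp: gwords_map_iff simp del: in_lists_conv_set)

lemma gens_iff [simp]:
  "SGen i \<in> vt_gens n \<longleftrightarrow> i \<in> {1..<n}" "RGen i \<in> vt_gens n \<longleftrightarrow> i \<in> {1..<n}"
  by (auto simp: vt_gens_def)

lemma cls_SS: "i \<in> {1..<n} \<Longrightarrow> cls n [SGen i, SGen i] = cls n []"
  and cls_RR: "i \<in> {1..<n} \<Longrightarrow> cls n [RGen i, RGen i] = cls n []"
  by (rule cls_rel; auto simp: vt_rels_def)+

lemma cls_far:
  assumes "i \<in> {1..<n}" "j \<in> {1..<n}" "i + 2 \<le> j \<or> j + 2 \<le> i"
  shows cls_SS_far: "cls n [SGen i, SGen j] = cls n [SGen j, SGen i]"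
    and cls_RR_far: "cls n [RGen i, RGen j] = cls n [RGen j, RGen i]"
    and cls_RS_far: "cls n [RGen i, SGen j] = cls n [SGen j, RGen i]"
proof -
  have "\<bar>int i - int j\<bar> \<ge> 2" "i \<in> {1..n - 1}" "j \<in> {1..n - 1}" using assms by auto
  then show "cls n [SGen i, SGen j] = cls n [SGen j, SGen i]"
    "cls n [RGen i, RGen j] = cls n [RGen j, RGen i]"
    "cls n [RGen i, SGen j] = cls n [SGen j, RGen i]"
    using assms(1,2) by (intro cls_rel; auto simp: vt_rels_def)+
qed

lemma cls_braid:
  assumes "1 \<le> i" "i + 1 < n"
  shows "cls n [RGen i, RGen (i + 1), RGen i] = cls n [RGen (i + 1), RGen i, RGen (i + 1)]"
    and "cls n [RGen i, RGen (i + 1), SGen i] = cls n [SGen (i + 1), RGen i, RGen (i + 1)]"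
proof -
  have "i \<in> {1..n - 2}" using assms by auto
  then show "cls n [RGen i, RGen (i + 1), RGen i] = cls n [RGen (i + 1), RGen i, RGen (i + 1)]"
    "cls n [RGen i, RGen (i + 1), SGen i] = cls n [SGen (i + 1), RGen i, RGen (i + 1)]"
    using assms by (intro cls_rel; auto simp: vt_rels_def)+
qed

lemma word_act_cls:
  assumes "cls n u = cls n v" "set u \<subseteq> vt_gens n" "pair.reduced (fst x)"
  shows "state_eq (word_act u x) (word_act v x)"
proof -
  have "set v \<subseteq> vt_gens n" using assms cls_empty_iff by metis
  then have "pres_eq (vt_gens n) (vt_rels n) (map (\<lambda>g. (g, True)) u) (map (\<lambda>g. (g, True)) v)"
    using assms cls_eq_iff by blast
  from word_act_pres_eq[OF this assms(3)] show ?thesis by (simp add: o_def)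
qed

lemma VT_carrier_cls:
  assumes "z \<in> carrier (VT n)"
  obtains u where "set u \<subseteq> vt_gens n" "z = cls n u"
proof -
  obtain w where w: "w \<in> gwords (vt_gens n)" and z: "z = pres_rel (vt_gens n) (vt_rels n) `` {w}"
    using assms unfolding VT_def presented_group_carrier by blast
  let ?u = "map fst w"
  have "pres_eq (vt_gens n) (vt_rels n) w (map (\<lambda>g. (g, True)) (map fst w))" if "w \<in> gwords (vt_gens n)" for w
    using that
  proof (induction w)
    case Nil
    show ?case by (simp add: pres_eq.refl)
  next
    case (Cons x w)
    obtain a b where x: "x = (a, b)" by force
    have a: "a \<in> vt_gens n" using Cons x by auto
    have "pres_eq (vt_gens n) (vt_rels n) [(a, b)] [(a, True)]"
    proof (cases b)
      case True
      then show ?thesis using a by (auto intro: pres_eq.refl)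
    next
      case False
      \<comment> \<open>For an involution, \<open>a\<^sup>-\<^sup>1 = a\<^sup>-\<^sup>1 (a a) = a\<close>.\<close>
      have "([(a, True), (a, True)], []) \<in> vt_rels n"
        using a by (cases a) (auto simp: vt_rels_def vt_gens_def)
      then have "pres_eq (vt_gens n) (vt_rels n) [] [(a, True), (a, True)]"
        using a by (intro pres_eq.sym[OF pres_eq.rel]) auto
      then have "pres_eq (vt_gens n) (vt_rels n) ([(a, False)] @ []) ([(a, False)] @ [(a, True), (a, True)])"
        using a by (intro pres_eq.app pres_eq.refl) auto
      moreover have "pres_eq (vt_gens n) (vt_rels n) ([(a, False), (a, True)] @ [(a, True)]) ([] @ [(a, True)])"
        using a pres_eq.cancel[OF a, of _ False] by (intro pres_eq.app pres_eq.refl) auto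
      ultimately show ?thesis using False by (auto intro: pres_eq.trans)
    qed
    then have "pres_eq (vt_gens n) (vt_rels n) ([(a, b)] @ w) ([(a, True)] @ map (\<lambda>g. (g, True)) (map fst w))"
      using Cons by (intro pres_eq.app) auto
    then show ?case by (simp add: x)
  qed
  from this[OF w] have eq: "pres_eq (vt_gens n) (vt_rels n) w (map (\<lambda>g. (g, True)) ?u)" .
  then have u: "map (\<lambda>g. (g, True)) ?u \<in> gwords (vt_gens n)" using pres_eq_words by blast
  have "z = cls n ?u" unfolding z cls_def using pres_class_eq_iff[OF w u] eq by blast
  moreover have "set ?u \<subseteq> vt_gens n" using u unfolding gwords_map_iff .
  ultimately show ?thesis using that by blast
qed

section \<open>The Coxeter presentation of the symmetric group\<close>
definition perm :: "nat list \<Rightarrow> nat \<Rightarrow> nat"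
  where "perm is = foldr (\<lambda>i p. transpose i (i + 1) \<circ> p) is id"

lemma perm_Nil [simp]: "perm [] = id"
  and perm_Cons [simp]: "perm (i # is) = transpose i (i + 1) \<circ> perm is"
  by (simp_all add: perm_def)

lemma perm_append [simp]: "perm (is @ js) = perm is \<circ> perm js"
  by (induction "is") (simp_all add: o_assoc)

lemma perm_rev_comp [simp]: "perm (rev is) \<circ> perm is = id"
proof (induction "is")
  case (Cons i "is")
  have "perm (rev (i # is)) \<circ> perm (i # is)
      = perm (rev is) \<circ> (transpose i (i + 1) \<circ> transpose i (i + 1)) \<circ> perm is"
    by (simp only: rev.simps perm_append perm_Cons perm_Nil o_assoc comp_id)
  then show ?case using Cons by (simp only: transpose_comp_involutory comp_id)
qed simp

lemma perm_comp_rev [simp]: "perm is \<circ> perm (rev is) = id"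
  using perm_rev_comp[of "rev is"] by simp

lemma bij_perm: "bij (perm is)"
  using perm_rev_comp perm_comp_rev by (rule o_bij)

lemma perm_permutes: "set is \<subseteq> {a..<n} \<Longrightarrow> perm is permutes {a..n}"
proof (induction "is")
  case (Cons i "is")
  then have "transpose i (i + 1) permutes {a..n}" by (intro permutes_swap_id) auto
  moreover have "perm is permutes {a..n}" using Cons by simp
  ultimately show ?case unfolding perm_Cons by (rule permutes_compose[rotated])
qed (simp add: permutes_id)

lemma perm_exists:
  assumes "p permutes {a..n}"
  obtains "is" where "set is \<subseteq> {a..<n}" "perm is = p"
proof -
  let ?H = "{perm is | is. set is \<subseteq> {a..<n}}"
  have mult: "p \<circ> q \<in> ?H" if pq: "p \<in> ?H" "q \<in> ?H" for p q
  proof -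
    obtain "is" js where "p = perm is" "q = perm js" "set is \<subseteq> {a..<n}" "set js \<subseteq> {a..<n}"
      using pq by blast
    then have "p \<circ> q = perm (is @ js)" "set (is @ js) \<subseteq> {a..<n}" by auto
    then show ?thesis by blast
  qed
  have adj: "transpose i (i + 1) \<in> ?H" if "a \<le> i" "i + 1 \<le> n" for i
    using that by (auto intro!: exI[of _ "[i]"])
  have less: "transpose i j \<in> ?H" if "a \<le> i" "i + 1 \<le> j" "j \<le> n" for i j
    using that(2,3)
  proof (induction j rule: dec_induct)
    case base
    then show ?case using adj that(1) by simp
  next
    case (step j)
    have "transpose i (Suc j) = transpose j (j + 1) \<circ> (transpose i j \<circ> transpose j (j + 1))"
      using step.hyps by (auto simp: fun_eq_iff transpose_def)
    moreover have "transpose j (j + 1) \<in> ?H"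
      using step.hyps step.prems that(1) by (intro adj) simp_all
    moreover have "transpose i j \<in> ?H" using step.prems by (intro step.IH) simp
    ultimately show ?case by (simp only: mult)
  qed
  have transp: "transpose i j \<in> ?H" if "i \<in> {a..n}" "j \<in> {a..n}" "i \<noteq> j" for i j
    using less[of i j] less[of j i] that
    by (cases "i < j") (auto simp: transpose_commute[of i j])
  have "p \<in> ?H" using assms finite_atLeastAtMost[of a n]
  proof (induction rule: permutes_induct)
    case id
    show ?case by (auto intro!: exI[of _ "[]"])
  next
    case (swap i j p)
    show ?case by (rule mult[OF transp[OF swap.hyps(1-3)] swap.IH])
  qed
  then show ?thesis using that by blast
qed

lemma word_act_RGen: "word_act (map RGen is) (w, p) = (relabel (perm is) w, perm is \<circ> p)"
proof (induction "is")
  case (Cons i "is")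
  then show ?case
    by (simp only: list.map word_act_Cons gen_act.simps relabel_comp perm_Cons o_assoc)
qed (simp add: prod.map_id0)

abbreviation rcls :: "nat \<Rightarrow> nat list \<Rightarrow> vt_gen gword set"
  where "rcls n is \<equiv> cls n (map RGen is)"

lemma rcls_cong: "rcls n u = rcls n v \<Longrightarrow> rcls n (p @ u @ q) = rcls n (p @ v @ q)"
  using cls_cong[of n "map RGen u" "map RGen v" "map RGen p" "map RGen q"] by simp

lemma rcls_rev_cancel: "set is \<subseteq> {1..<n} \<Longrightarrow> rcls n (rev is @ is) = rcls n []"
proof (induction "is")
  case (Cons i "is")
  have "rcls n (rev is @ [i, i] @ is) = rcls n (rev is @ [] @ is)"
    using Cons.prems by (intro rcls_cong) (simp add: cls_RR)
  then show ?case using Cons by simp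
qed simp

lemma cls_commute_list:
  assumes "\<And>j. j \<in> set v \<Longrightarrow> cls n [j, g] = cls n [g, j]"
  shows "cls n (v @ [g]) = cls n (g # v)"
  using assms
proof (induction v)
  case (Cons j v)
  have "cls n ([j] @ (v @ [g]) @ []) = cls n ([j] @ (g # v) @ [])"
    using Cons by (intro cls_cong) simp
  also have "\<dots> = cls n ([] @ [j, g] @ v)" by simp
  also have "\<dots> = cls n ([] @ [g, j] @ v)" using Cons.prems by (intro cls_cong) simp
  finally show ?case by simp
qed simp

lemma rcls_far:
  assumes "j \<in> {1..<n}" "set v \<subseteq> {1..<n}" "\<And>i. i \<in> set v \<Longrightarrow> i + 2 \<le> j \<or> j + 2 \<le> i"
  shows "rcls n (v @ [j]) = rcls n (j # v)"
proof -
  have "cls n [g, RGen j] = cls n [RGen j, g]" if g: "g \<in> set (map RGen v)" for g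
  proof -
    obtain i where "g = RGen i" "i \<in> set v" using g by auto
    then show ?thesis using cls_RR_far[of i n j] assms by blast
  qed
  from cls_commute_list[of "map RGen v" n "RGen j", OF this] show ?thesis by simp
qed

text \<open>The words \<open>\<rho>\<^sub>m \<rho>\<^sub>m\<^sub>-\<^sub>1 \<dots> \<rho>\<^sub>k\<close> with \<open>1 \<le> k \<le> m + 1\<close> represent the cosets of
  \<open>S\<^sub>m\<close> in \<open>S\<^sub>m\<^sub>+\<^sub>1\<close>; the word is empty for \<open>k = m + 1\<close>.\<close>
definition descent :: "nat \<Rightarrow> nat \<Rightarrow> nat list"
  where "descent m k = rev [k..<Suc m]"

lemma descent_snoc: "k \<le> m \<Longrightarrow> descent m k = descent m (Suc k) @ [k]"
  by (simp add: descent_def upt_conv_Cons del: upt_Suc)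

lemma perm_descent: "k \<le> Suc m \<Longrightarrow> perm (descent m k) k = Suc m"
proof (induction m)
  case 0
  then have "k = 0 \<or> k = 1" by auto
  then show ?case by (auto simp: descent_def)
next
  case (Suc m)
  then show ?case by (cases "k = Suc (Suc m)") (auto simp: descent_def)
qed

text \<open>Right multiplication by a generator permutes the cosets of the descents, by the relations alone.
  The interesting case is \<open>k < j\<close>, where moving \<open>\<rho>\<^sub>j\<close> to the left through the descent meets one
  braid relation and turns it into \<open>\<rho>\<^sub>j\<^sub>-\<^sub>1\<close>.\<close>
lemma coset_step:
  assumes "1 \<le> k" "k \<le> Suc m" "m < n" "1 \<le> j" "j \<le> m"
  obtains v l where "set v \<subseteq> {1..<m}" "1 \<le> l" "l \<le> Suc m"
    "rcls n (descent m k @ [j]) = rcls n (v @ descent m l)"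
proof -
  consider "j + 2 \<le> k" | "j + 1 = k" | "j = k" | "k < j" by linarith
  then show ?thesis
  proof cases
    case 1
    have "rcls n (descent m k @ [j]) = rcls n ([j] @ descent m k)"
      unfolding append.simps by (rule rcls_far) (use assms 1 in \<open>auto simp: descent_def\<close>)
    then show ?thesis using that[of "[j]" k] assms 1 by auto
  next
    case 2
    then show ?thesis using that[of "[]" j] assms descent_snoc[of j m] by simp
  next
    case 3
    have "rcls n (descent m (Suc k) @ [k, k] @ []) = rcls n (descent m (Suc k) @ [] @ [])"
      using assms 3 by (intro rcls_cong) (simp add: cls_RR)
    then show ?thesis using that[of "[]" "Suc k"] assms 3 descent_snoc[of k m] by simp
  next
    case 4
    define A where "A = descent m (Suc j)"
    define B where "B = rev [k..<j - 1]"
    have "[k..<Suc m] = [k..<j - 1] @ [j - 1, j] @ [Suc j..<Suc m]"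
    proof -
      have "[k..<Suc m] = [k..<j - 1] @ [j - 1..<Suc m]"
        using upt_add_eq_append[of k "j - 1" "Suc m - (j - 1)"] 4 assms by simp
      also have "[j - 1..<Suc m] = [j - 1, j] @ [Suc j..<Suc m]"
        using 4 assms by (simp add: upt_conv_Cons del: upt_Suc)
      finally show ?thesis .
    qed
    then have D: "descent m k = A @ [j, j - 1] @ B" by (simp add: descent_def A_def B_def del: upt_Suc)
    have "rcls n ((A @ [j, j - 1]) @ (B @ [j]) @ []) = rcls n ((A @ [j, j - 1]) @ (j # B) @ [])"
      using assms 4 by (intro rcls_cong rcls_far) (auto simp: B_def)
    also have "\<dots> = rcls n (A @ [j, j - 1, j] @ B)" by simp
    also have "\<dots> = rcls n (A @ [j - 1, j, j - 1] @ B)"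
      using cls_braid(1)[of "j - 1" n] assms 4 by (intro rcls_cong) simp
    also have "\<dots> = rcls n ([] @ (A @ [j - 1]) @ ([j, j - 1] @ B))" by simp
    also have "\<dots> = rcls n ([] @ ((j - 1) # A) @ ([j, j - 1] @ B))"
      using assms 4 by (intro rcls_cong rcls_far) (auto simp: A_def descent_def)
    finally have "rcls n (descent m k @ [j]) = rcls n ([j - 1] @ descent m k)" by (simp add: D)
    moreover have "set [j - 1] \<subseteq> {1..<m}" using assms 4 by auto
    ultimately show ?thesis using that[of "[j - 1]" k] assms by blast
  qed
qed

lemma coset_form:
  assumes "set is \<subseteq> {1..m}" "m < n"
  obtains v k where "set v \<subseteq> {1..<m}" "1 \<le> k" "k \<le> Suc m" "rcls n is = rcls n (v @ descent m k)"
proof -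
  have "\<exists>v k. set v \<subseteq> {1..<m} \<and> 1 \<le> k \<and> k \<le> Suc m \<and> rcls n is = rcls n (v @ descent m k)"
    using assms(1)
  proof (induction "is" rule: rev_induct)
    case Nil
    show ?case by (rule exI[of _ "[]"], rule exI[of _ "Suc m"]) (simp add: descent_def)
  next
    case (snoc j "is")
    then obtain v k where v: "set v \<subseteq> {1..<m}" "1 \<le> k" "k \<le> Suc m"
      "rcls n is = rcls n (v @ descent m k)" by auto
    obtain v' l where v': "set v' \<subseteq> {1..<m}" "1 \<le> l" "l \<le> Suc m"
        "rcls n (descent m k @ [j]) = rcls n (v' @ descent m l)"
      by (rule coset_step[of k m n j]) (use v assms(2) snoc.prems in auto)
    have "rcls n ([] @ is @ [j]) = rcls n ([] @ (v @ descent m k) @ [j])"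
      using v(4) by (rule rcls_cong)
    also have "\<dots> = rcls n (v @ (descent m k @ [j]) @ [])" by simp
    also have "\<dots> = rcls n (v @ (v' @ descent m l) @ [])"
      using v'(4) by (rule rcls_cong)
    finally have "rcls n (is @ [j]) = rcls n ((v @ v') @ descent m l)" by simp
    then show ?case using v v' by (intro exI[of _ "v @ v'"] exI[of _ l]) auto
  qed
  then show ?thesis using that by blast
qed

lemma perm_cong:
  assumes "rcls n is = rcls n js" "set is \<subseteq> {1..<n}"
  shows "perm is = perm js"
proof -
  have "set (map RGen is) \<subseteq> vt_gens n" using assms(2) by auto
  from word_act_cls[OF assms(1) this, of "([], id)"]
  show ?thesis by (simp add: word_act_RGen state_eq_def)
qed

text \<open>Induction on the rank: a descent takes \<open>k\<close> to \<open>m + 1\<close>, a point that is fixed by words in the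
  smaller generators. For the identity permutation this leaves only the empty descent.\<close>
lemma coxeter_trivial:
  "set is \<subseteq> {1..m} \<Longrightarrow> m < n \<Longrightarrow> perm is = id \<Longrightarrow> rcls n is = rcls n []"
proof (induction m arbitrary: "is")
  case (Suc m)
  obtain v k where v: "set v \<subseteq> {1..<Suc m}" "1 \<le> k" "k \<le> Suc (Suc m)"
      "rcls n is = rcls n (v @ descent (Suc m) k)"
    using coset_form Suc.prems by blast
  have "set is \<subseteq> {1..<n}" using Suc.prems by auto
  then have id: "perm (v @ descent (Suc m) k) = id"
    using perm_cong[OF v(4)] Suc.prems by metis
  then have "perm v (Suc (Suc m)) = k"
    using perm_descent[OF v(3)] by (metis comp_apply id_apply perm_append)
  moreover have "perm v permutes {1..Suc m}" using v(1) by (rule perm_permutes)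
  then have "perm v (Suc (Suc m)) = Suc (Suc m)" by (simp add: permutes_not_in)
  ultimately have "descent (Suc m) k = []" by (simp add: descent_def)
  then have "rcls n is = rcls n v" "perm v = id"
    using v(4) id by simp_all
  moreover have "set v \<subseteq> {1..m}" using v(1) by auto
  ultimately show ?case using Suc.IH[of v] Suc.prems(2) by simp
qed simp

lemma coxeter_unique:
  assumes "set is \<subseteq> {1..<n}" "set js \<subseteq> {1..<n}" "perm is = perm js"
  shows "rcls n is = rcls n js"
proof (cases n)
  case 0
  then show ?thesis using assms by simp
next
  case (Suc m)
  have "rcls n (is @ rev js) = rcls n []"
    using assms Suc by (intro coxeter_trivial[of _ m]) auto
  then have "rcls n ([] @ (is @ rev js) @ js) = rcls n ([] @ [] @ js)" by (rule rcls_cong)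
  moreover have "rcls n (is @ (rev js @ js) @ []) = rcls n (is @ [] @ [])"
    using rcls_rev_cancel[OF assms(2)] by (rule rcls_cong)
  ultimately show ?thesis by simp
qed

section \<open>Conjugates of the first twin generator\<close>
lemma permutes_extend:
  assumes "distinct xs" "distinct ys" "length xs = length ys" "set xs \<subseteq> A" "set ys \<subseteq> A"
  obtains p where "p permutes A" "map p xs = ys"
proof -
  have "\<exists>p. p permutes A \<and> map p xs = ys"
    using assms(3,1,2,4,5)
  proof (induction xs ys rule: list_induct2)
    case Nil
    show ?case by (intro exI conjI, rule permutes_id) simp
  next
    case (Cons x xs y ys)
    then obtain p where p: "p permutes A" "map p xs = ys" by auto
    have "p x \<in> A" using p(1) Cons.prems by (simp add: permutes_in_image)
    then have "transpose (p x) y permutes A"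
      using Cons.prems by (intro permutes_swap_id) auto
    then have perm: "transpose (p x) y \<circ> p permutes A" by (rule permutes_compose[OF p(1)])
    have "(transpose (p x) y \<circ> p) z = p z" if "z \<in> set xs" for z
    proof -
      have "z \<noteq> x" using that Cons.prems by auto
      then have "p z \<noteq> p x" using permutes_inj[OF p(1)] by (simp add: inj_eq)
      moreover have "p z \<in> set ys" using that p(2) by auto
      then have "p z \<noteq> y" using Cons.prems by auto
      ultimately show ?thesis by (simp add: transpose_apply_other)
    qed
    then have "map (transpose (p x) y \<circ> p) xs = map p xs" by (rule map_cong[OF HOL.refl])
    then have "map (transpose (p x) y \<circ> p) (x # xs) = y # ys" using p(2) by simp
    then show ?case using perm by (intro exI conjI)
  qed
  then show ?thesis using that by blast
qed

definition conj_word :: "nat list \<Rightarrow> nat \<Rightarrow> vt_gen list"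
  where "conj_word is i = map RGen is @ [SGen i] @ map RGen (rev is)"

lemma conj_word_append: "conj_word (is @ js) i = map RGen is @ conj_word js i @ map RGen (rev is)"
  by (simp add: conj_word_def)

lemma RGen_rev_cancel:
  assumes "set is \<subseteq> {1..<n}"
  shows "cls n (p @ map RGen (rev is) @ map RGen is @ q) = cls n (p @ q)"
    and "cls n (p @ map RGen is @ map RGen (rev is) @ q) = cls n (p @ q)"
  using cls_cong[OF rcls_rev_cancel[OF assms], of p q]
    cls_cong[OF rcls_rev_cancel[of "rev is" n], of p q] assms by simp_all

text \<open>If two words in the \<open>\<rho>\<^sub>k\<close> agree on \<open>1\<close> and \<open>2\<close>, their quotient permutes
  \<open>{3..n}\<close>. By the Coxeter presentation it is a product of \<open>\<rho>\<^sub>3, \<dots>, \<rho>\<^sub>n\<^sub>-\<^sub>1\<close>, all of which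
  commute with \<open>s\<^sub>1\<close>.\<close>
lemma conj_word_unique:
  assumes n: "2 \<le> n" and "is": "set is \<subseteq> {1..<n}" and js: "set js \<subseteq> {1..<n}"
    and eq: "perm is 1 = perm js 1" "perm is 2 = perm js 2"
  shows "cls n (conj_word is 1) = cls n (conj_word js 1)"
proof -
  let ?p = "perm (rev js @ is)"
  have "?p permutes {1..n}"
    using "is" js by (intro perm_permutes) auto
  then have "?p permutes {3..n}"
  proof (rule permutes_superset)
    fix x assume "x \<in> {1..n} - {3..n}"
    then have "x = 1 \<or> x = 2" by auto
    moreover have "?p 1 = 1" "?p 2 = 2"
    using eq perm_rev_comp[of js] by (simp_all add: pointfree_idE)
    ultimately show "?p x = x" by metis
  qed
  then obtain ks where ks: "set ks \<subseteq> {3..<n}" "perm ks = ?p" by (rule perm_exists)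
  have ks': "set ks \<subseteq> {1..<n}" using ks by auto
  have e1: "rcls n (rev js @ is) = rcls n ks"
    by (rule coxeter_unique) (use ks ks' "is" js in auto)
  have e2: "cls n (map RGen ks @ [SGen 1]) = cls n (SGen 1 # map RGen ks)"
  proof (rule cls_commute_list)
    fix g assume "g \<in> set (map RGen ks)"
    then obtain i where "g = RGen i" "i \<in> set ks" by auto
    then show "cls n [g, SGen 1] = cls n [SGen 1, g]"
      using cls_RS_far[of i n 1] ks by fastforce
  qed
  let ?R = "map RGen"
  have "cls n (conj_word is 1) = cls n (?R js @ ?R (rev js @ is) @ [SGen 1] @ ?R (rev is))"
    using RGen_rev_cancel(2)[OF js, of "[]"] by (simp add: conj_word_def)
  also have "\<dots> = cls n (?R js @ ?R ks @ [SGen 1] @ ?R (rev is))"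
    using e1 by (rule cls_cong)
  also have "\<dots> = cls n (?R js @ (SGen 1 # ?R ks) @ ?R (rev is))"
    using cls_cong[OF e2] by simp
  also have "\<dots> = cls n ((?R js @ [SGen 1]) @ ?R ks @ ?R (rev is))" by simp
  also have "\<dots> = cls n ((?R js @ [SGen 1]) @ ?R (rev js @ is) @ ?R (rev is))"
    using e1[symmetric] by (rule cls_cong)
  also have "\<dots> = cls n (conj_word js 1)"
    using RGen_rev_cancel(2)[OF "is", of "?R js @ [SGen 1] @ ?R (rev js)" "[]"] by (simp add: conj_word_def)
  finally show ?thesis .
qed

definition letters :: "nat \<Rightarrow> (nat \<times> nat) set"
  where "letters n = {(i, j). i \<in> {1..n} \<and> j \<in> {1..n} \<and> i \<noteq> j}"

definition letter_conj :: "nat \<Rightarrow> nat \<times> nat \<Rightarrow> nat list"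
  where "letter_conj n a = (SOME is. set is \<subseteq> {1..<n} \<and> perm is 1 = fst a \<and> perm is 2 = snd a)"

definition letter_word :: "nat \<Rightarrow> nat \<times> nat \<Rightarrow> vt_gen list"
  where "letter_word n a = conj_word (letter_conj n a) 1"

lemma letter_conj:
  assumes "a \<in> letters n"
  shows "set (letter_conj n a) \<subseteq> {1..<n}" "perm (letter_conj n a) 1 = fst a"
    "perm (letter_conj n a) 2 = snd a"
proof -
  have n: "2 \<le> n" using assms by (auto simp: letters_def)
  obtain p where "p permutes {1..n}" "map p [1, 2] = [fst a, snd a]"
    by (rule permutes_extend[of "[1, 2]" "[fst a, snd a]" "{1..n}"])
      (use assms n in \<open>auto simp: letters_def\<close>)
  moreover from this(1) obtain "is" where "set is \<subseteq> {1..<n}" "perm is = p" by (rule perm_exists)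
  ultimately have "\<exists>is. set is \<subseteq> {1..<n} \<and> perm is 1 = fst a \<and> perm is 2 = snd a" by auto
  from someI_ex[OF this]
  show "set (letter_conj n a) \<subseteq> {1..<n}" "perm (letter_conj n a) 1 = fst a"
    "perm (letter_conj n a) 2 = snd a"
    unfolding letter_conj_def by blast+
qed

lemma letters_ge2: "a \<in> letters n \<Longrightarrow> 2 \<le> n"
  by (auto simp: letters_def)

lemma letter_word_gens: "a \<in> letters n \<Longrightarrow> set (letter_word n a) \<subseteq> vt_gens n"
  using letter_conj(1)[of a n] letters_ge2[of a n] by (auto simp: letter_word_def conj_word_def)

lemma letters_perm: "set is \<subseteq> {1..<n} \<Longrightarrow> map_prod (perm is) (perm is) a \<in> letters n \<longleftrightarrow> a \<in> letters n"
proof -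
  assume "set is \<subseteq> {1..<n}"
  then have "perm is i \<in> {1..n} \<longleftrightarrow> i \<in> {1..n}" for i
    by (intro permutes_in_image perm_permutes)
  moreover have "perm is i = perm is j \<longleftrightarrow> i = j" for i j
    using bij_is_inj[OF bij_perm] by (rule inj_eq)
  ultimately show ?thesis
    unfolding letters_def by (cases a) (simp only: map_prod_simp mem_Collect_eq case_prod_conv)
qed

lemma letter_word_eq:
  assumes a: "a \<in> letters n" and "is": "set is \<subseteq> {1..<n}"
    and "perm is 1 = fst a" "perm is 2 = snd a"
  shows "cls n (letter_word n a) = cls n (conj_word is 1)"
  unfolding letter_word_def
  using letters_ge2[OF a] letter_conj(1)[OF a] "is"
  by (rule conj_word_unique) (simp_all only: assms letter_conj[OF a])

text \<open>Since the conjugating word may be chosen freely, conjugation by the \<open>\<rho>\<^sub>k\<close> simply relabels.\<close>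
lemma letter_word_conj:
  assumes a: "a \<in> letters n" and "is": "set is \<subseteq> {1..<n}"
  shows "cls n (map RGen is @ letter_word n a @ map RGen (rev is))
    = cls n (letter_word n (map_prod (perm is) (perm is) a))"
proof -
  have "map_prod (perm is) (perm is) a \<in> letters n" using letters_perm[OF "is"] a by blast
  moreover have "set (is @ letter_conj n a) \<subseteq> {1..<n}" using "is" letter_conj(1)[OF a] by simp
  ultimately have "cls n (letter_word n (map_prod (perm is) (perm is) a))
      = cls n (conj_word (is @ letter_conj n a) 1)"
    by (rule letter_word_eq) (simp_all only: perm_append comp_apply letter_conj[OF a] fst_map_prod snd_map_prod)
  then show ?thesis by (simp add: letter_word_def[of n a] conj_word_append)
qed

lemma letter_word_swap:
  assumes a: "a \<in> letters n" and "is": "set is \<subseteq> {1..<n}"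
  shows "cls n (map RGen is @ letter_word n a)
    = cls n (letter_word n (map_prod (perm is) (perm is) a) @ map RGen is)"
proof -
  have "cls n ([] @ (map RGen is @ letter_word n a @ map RGen (rev is)) @ map RGen is)
      = cls n ([] @ letter_word n (map_prod (perm is) (perm is) a) @ map RGen is)"
    using letter_word_conj[OF assms] by (rule cls_cong)
  then show ?thesis using RGen_rev_cancel(1)[OF "is", of "map RGen is @ letter_word n a" "[]"] by simp
qed

lemma letter_word_square:
  assumes "a \<in> letters n"
  shows "cls n (letter_word n a @ letter_word n a) = cls n []"
proof -
  let ?is = "letter_conj n a"
  note "is" = letter_conj(1)[OF assms]
  have "cls n (letter_word n a @ letter_word n a)
      = cls n (map RGen ?is @ [SGen 1, SGen 1] @ map RGen (rev ?is))"
    using RGen_rev_cancel(1)[OF "is", of "map RGen ?is @ [SGen 1]" "SGen 1 # map RGen (rev ?is)"]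
    by (simp add: letter_word_def conj_word_def)
  also have "\<dots> = cls n (map RGen ?is @ [] @ map RGen (rev ?is))"
    using letters_ge2[OF assms] by (intro cls_cong cls_SS) auto
  finally show ?thesis using RGen_rev_cancel(2)[OF "is", of "[]" "[]"] by simp
qed

text \<open>The mixed relation conjugates \<open>s\<^sub>i\<close> to \<open>s\<^sub>i\<^sub>+\<^sub>1\<close> by \<open>\<rho>\<^sub>i \<rho>\<^sub>i\<^sub>+\<^sub>1\<close>, whose
  permutation takes \<open>(i, i + 1)\<close> to \<open>(i + 1, i + 2)\<close>.\<close>
lemma letter_word_SGen:
  assumes "1 \<le> i" "i < n"
  shows "cls n (letter_word n (i, i + 1)) = cls n [SGen i]"
proof -
  have "\<exists>is. set is \<subseteq> {1..<n} \<and> perm is 1 = i \<and> perm is 2 = i + 1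
    \<and> cls n (conj_word is 1) = cls n [SGen i]"
    using assms
  proof (induction i rule: dec_induct)
    case base
    show ?case by (rule exI[of _ "[]"]) (simp add: conj_word_def)
  next
    case (step i)
    then obtain "is" where "is": "set is \<subseteq> {1..<n}" "perm is 1 = i" "perm is 2 = i + 1"
      "cls n (conj_word is 1) = cls n [SGen i]" by auto
    let ?js = "[i, i + 1]"
    have js: "set ?js \<subseteq> {1..<n}" using step by auto
    have "cls n (conj_word (?js @ is) 1) = cls n (map RGen ?js @ [SGen i] @ map RGen (rev ?js))"
      unfolding conj_word_append using "is"(4) by (rule cls_cong)
    also have "\<dots> = cls n ([] @ [RGen i, RGen (i + 1), SGen i] @ map RGen (rev ?js))" by simp
    also have "\<dots> = cls n ([] @ [SGen (i + 1), RGen i, RGen (i + 1)] @ map RGen (rev ?js))"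
      using step by (intro cls_cong cls_braid) auto
    also have "\<dots> = cls n [SGen (i + 1)]"
      using RGen_rev_cancel(2)[OF js, of "[SGen (i + 1)]" "[]"] by simp
    finally show ?case
      using "is" js by (intro exI[of _ "?js @ is"]) (auto simp: transpose_def)
  qed
  then obtain "is" where "is": "set is \<subseteq> {1..<n}" "perm is 1 = i" "perm is 2 = i + 1"
    "cls n (conj_word is 1) = cls n [SGen i]" by blast
  then show ?thesis
    using letter_word_eq[of "(i, i + 1)" n "is"] assms by (auto simp: letters_def)
qed

text \<open>A suitable permutation conjugates the two letters simultaneously to \<open>s\<^sub>1\<close> and \<open>s\<^sub>3\<close>.\<close>
lemma letter_word_commute:
  assumes a: "a \<in> letters n" and b: "b \<in> letters n" and "\<not> meets a b"
  shows "cls n (letter_word n a @ letter_word n b) = cls n (letter_word n b @ letter_word n a)"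
proof -
  obtain i j k l where ab: "a = (i, j)" "b = (k, l)" by (cases a, cases b)
  have d: "distinct [i, j, k, l]" and s: "set [i, j, k, l] \<subseteq> {1..n}"
    using assms by (auto simp: ab letters_def meets_def)
  have "card (set [i, j, k, l]) \<le> n" using card_mono[OF _ s] by simp
  then have n: "4 \<le> n" using d distinct_card by fastforce
  obtain p where "p permutes {1..n}" and p: "map p [1, 2, 3, 4] = [i, j, k, l]"
    by (rule permutes_extend[of "[1, 2, 3, 4]" "[i, j, k, l]" "{1..n}"]) (use d s n in auto)
  from this(1) obtain "is" where "is": "set is \<subseteq> {1..<n}" "perm is = p" by (rule perm_exists)
  let ?P = "map RGen is" and ?Q = "map RGen (rev is)"
  have *: "cls n (letter_word n (map_prod p p (m, m + 1))) = cls n (?P @ [SGen m] @ ?Q)"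
    if "1 \<le> m" "m < n" for m
    using letter_word_conj[of "(m, m + 1)" n "is"] cls_cong[OF letter_word_SGen[OF that], of ?P ?Q]
      "is" that by (auto simp: letters_def)
  have A: "cls n (letter_word n a) = cls n (?P @ [SGen 1] @ ?Q)"
    using *[of 1] n p by (simp add: ab numeral_eq_Suc)
  have B: "cls n (letter_word n b) = cls n (?P @ [SGen 3] @ ?Q)"
    using *[of 3] n p by (simp add: ab)
  have "cls n (letter_word n a @ letter_word n b) = cls n ((?P @ [SGen 1] @ ?Q) @ (?P @ [SGen 3] @ ?Q))"
    using A B by (rule cls_append_cong)
  also have "\<dots> = cls n (?P @ [SGen 1, SGen 3] @ ?Q)"
    using RGen_rev_cancel(1)[OF "is"(1), of "?P @ [SGen 1]" "SGen 3 # ?Q"] by simp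
  also have "\<dots> = cls n (?P @ [SGen 3, SGen 1] @ ?Q)"
    using n by (intro cls_cong cls_SS_far) auto
  also have "\<dots> = cls n ((?P @ [SGen 3] @ ?Q) @ (?P @ [SGen 1] @ ?Q))"
    using RGen_rev_cancel(1)[OF "is"(1), of "?P @ [SGen 3]" "SGen 1 # ?Q"] by simp
  also have "\<dots> = cls n (letter_word n b @ letter_word n a)"
    using B[symmetric] A[symmetric] by (rule cls_append_cong)
  finally show ?thesis .
qed

section \<open>Normal forms\<close>
definition expand :: "nat \<Rightarrow> (nat \<times> nat) list \<Rightarrow> vt_gen list"
  where "expand n w = concat (map (letter_word n) w)"

lemma expand_simps [simp]: "expand n [] = []" "expand n (a # w) = letter_word n a @ expand n w"
  by (simp_all add: expand_def)

lemma expand_front: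
  "set w \<subseteq> letters n \<Longrightarrow> pair.front a w \<Longrightarrow>
    cls n (expand n w) = cls n (letter_word n a @ expand n (remove1 a w))"
proof (induction w)
  case (Cons x w)
  show ?case
  proof (cases "x = a")
    case False
    then have x: "\<not> meets a x" "pair.front a w" using Cons.prems by auto
    then have a: "a \<in> letters n" using Cons.prems(1)
      by (induction w) auto
    have "cls n (letter_word n x @ expand n w @ [])
        = cls n (letter_word n x @ (letter_word n a @ expand n (remove1 a w)) @ [])"
      using Cons x by (intro cls_cong) auto
    also have "\<dots> = cls n ([] @ (letter_word n x @ letter_word n a) @ expand n (remove1 a w))" by simp
    also have "\<dots> = cls n ([] @ (letter_word n a @ letter_word n x) @ expand n (remove1 a w))"
      using letter_word_commute[OF a, of x] x Cons.prems by (intro cls_cong) auto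
    finally show ?thesis using False by simp
  qed simp
qed simp

lemma expand_act:
  assumes "set w \<subseteq> letters n" "a \<in> letters n"
  shows "cls n (expand n (pair.act a w)) = cls n (letter_word n a @ expand n w)"
proof (cases "pair.front a w")
  case True
  have "cls n (letter_word n a @ expand n w @ [])
      = cls n (letter_word n a @ (letter_word n a @ expand n (remove1 a w)) @ [])"
    using expand_front[OF assms(1) True] by (rule cls_cong)
  also have "\<dots> = cls n ([] @ (letter_word n a @ letter_word n a) @ expand n (remove1 a w))" by simp
  also have "\<dots> = cls n ([] @ [] @ expand n (remove1 a w))"
    using letter_word_square[OF assms(2)] by (rule cls_cong)
  finally show ?thesis using True by (simp add: pair.act_def)
qed (simp add: pair.act_def)

lemma expand_relabel:
  assumes "is": "set is \<subseteq> {1..<n}"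
  shows "set w \<subseteq> letters n \<Longrightarrow>
    cls n (map RGen is @ expand n w) = cls n (expand n (relabel (perm is) w) @ map RGen is)"
proof (induction w)
  case (Cons a w)
  let ?b = "map_prod (perm is) (perm is) a"
  have "cls n ([] @ (map RGen is @ letter_word n a) @ expand n w)
      = cls n ([] @ (letter_word n ?b @ map RGen is) @ expand n w)"
    using Cons.prems by (intro cls_cong letter_word_swap "is") auto
  also have "\<dots> = cls n (letter_word n ?b @ (map RGen is @ expand n w) @ [])" by simp
  also have "\<dots> = cls n (letter_word n ?b @ (expand n (relabel (perm is) w) @ map RGen is) @ [])"
    using Cons by (intro cls_cong) auto
  finally show ?case by simp
qed simp

lemma normal_form:
  assumes "set u \<subseteq> vt_gens n"
  obtains w "is" where "set w \<subseteq> letters n" "pair.reduced w" "set is \<subseteq> {1..<n}"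
    "cls n u = cls n (expand n w @ map RGen is)"
proof -
  have "\<exists>w is. set w \<subseteq> letters n \<and> pair.reduced w \<and> set is \<subseteq> {1..<n}
      \<and> cls n u = cls n (expand n w @ map RGen is)"
    using assms
  proof (induction u)
    case Nil
    show ?case by (rule exI[of _ "[]"], rule exI[of _ "[]"]) simp
  next
    case (Cons g u)
    then obtain w "is" where w: "set w \<subseteq> letters n" "pair.reduced w" "set is \<subseteq> {1..<n}"
      and u: "cls n u = cls n (expand n w @ map RGen is)" by auto
    have gu: "cls n (g # u) = cls n ([g] @ expand n w @ map RGen is)"
      using cls_append_cong[OF HOL.refl u, of "[g]"] by simp
    show ?case
    proof (cases g)
      case (SGen i)
      then have i: "1 \<le> i" "i < n" and a: "(i, i + 1) \<in> letters n"
        using Cons.prems by (auto simp: letters_def)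
      have "cls n ([] @ [g] @ expand n w @ map RGen is)
          = cls n ([] @ letter_word n (i, i + 1) @ expand n w @ map RGen is)"
        using letter_word_SGen[OF i] SGen by (intro cls_cong) simp
      also have "\<dots> = cls n ([] @ (letter_word n (i, i + 1) @ expand n w) @ map RGen is)" by simp
      also have "\<dots> = cls n ([] @ expand n (pair.act (i, i + 1) w) @ map RGen is)"
        using expand_act[OF w(1) a] by (intro cls_cong) simp
      finally have "cls n (g # u) = cls n (expand n (pair.act (i, i + 1) w) @ map RGen is)"
        using gu by simp
      moreover have "set (pair.act (i, i + 1) w) \<subseteq> letters n"
        using w(1) a set_remove1_subset[of "(i, i + 1)" w] by (auto simp: pair.act_def)
      ultimately show ?thesis using w pair.reduced_act by blast
    next
      case (RGen i)
      then have i: "set [i] \<subseteq> {1..<n}" using Cons.prems by auto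
      have "cls n ([] @ (map RGen [i] @ expand n w) @ map RGen is)
          = cls n ([] @ (expand n (relabel (perm [i]) w) @ map RGen [i]) @ map RGen is)"
        using expand_relabel[OF i w(1)] by (rule cls_cong)
      then have "cls n (g # u) = cls n (expand n (relabel (perm [i]) w) @ map RGen (i # is))"
        using gu RGen by simp
      moreover have "set (relabel (perm [i]) w) \<subseteq> letters n"
        using w(1) letters_perm[OF i] by auto
      moreover have "pair.reduced (relabel (perm [i]) w)"
        using w(2) dependence_automorphism.reduced_map[OF pair_automorphism[OF bij_perm]] by blast
      moreover have "set (i # is) \<subseteq> {1..<n}" using w(3) i by simp
      ultimately show ?thesis by blast
    qed
  qed
  then show ?thesis using that by blast
qed

text \<open>The elements \<open>[i,j]\<close> act by the letters that they are meant to be, so the action recovers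
  the normal form of an element.\<close>
lemma word_act_letter_word:
  assumes "a \<in> letters n"
  shows "word_act (letter_word n a) (w, p) = (pair.act a w, p)"
proof -
  let ?q = "perm (letter_conj n a)" and ?r = "perm (rev (letter_conj n a))"
  have "relabel ?q (pair.act (1, 2) (relabel ?r w)) = pair.act (map_prod ?q ?q (1, 2)) (relabel ?q (relabel ?r w))"
    by (rule dependence_automorphism.act_map[OF pair_automorphism[OF bij_perm], symmetric])
  also have "\<dots> = pair.act a w"
    unfolding relabel_comp perm_comp_rev using letter_conj[OF assms] by (simp add: prod.map_id0)
  moreover have "?q \<circ> (?r \<circ> p) = p" by (metis o_assoc perm_comp_rev id_comp)
  ultimately show ?thesis
    unfolding letter_word_def conj_word_def word_act_append word_act_RGen
    by (simp only: word_act_Cons word_act_Nil gen_act.simps word_act_RGen one_add_one)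
qed

lemma word_act_expand:
  "set w \<subseteq> letters n \<Longrightarrow> word_act (expand n w) (v, p) = (foldr pair.act w v, p)"
  by (induction w) (simp_all add: word_act_letter_word)

section \<open>Elements that commute with the pure virtual twin group\<close>

text \<open>The value of the projection to \<open>S\<^sub>n\<close>, under which the \<open>s\<^sub>i\<close> go to transpositions as well.
  It differs from the second component of \<open>word_act\<close>, where the \<open>s\<^sub>i\<close> leave the permutation
  unchanged.\<close>
definition word_perm :: "vt_gen list \<Rightarrow> nat \<Rightarrow> nat"
  where "word_perm u = foldr (\<lambda>g p. vt_gen_perm g \<circ> p) u id"

lemma word_perm_append: "word_perm (u @ v) = word_perm u \<circ> word_perm v"
  by (induction u) (simp_all add: word_perm_def o_assoc)

lemma word_perm_RGen: "word_perm (map RGen is) = perm is"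
  by (simp add: word_perm_def perm_def foldr_map o_def)

lemma vt_pi_cls:
  assumes "set u \<subseteq> vt_gens n"
  shows "vt_pi n (cls n u) = word_perm u"
proof -
  have "vt_pi n (cls n u) = word_eval (sym_group n) vt_gen_perm (map (\<lambda>g. (g, True)) u)"
    unfolding vt_pi_def cls_def
    by (rule group.pres_lift_class[OF sym_group_is_group vt_gen_perm_closed vt_gen_perm_rels])
      (use assms in \<open>simp_all only: gwords_map_iff\<close>)
  also have "\<dots> = word_perm u"
    by (induction u) (simp_all add: word_eval_def word_perm_def sym_group_mult sym_group_one)
  finally show ?thesis .
qed

lemma word_perm_letter_word:
  assumes "a \<in> letters n"
  shows "word_perm (letter_word n a) = transpose (fst a) (snd a)"
proof -
  let ?q = "perm (letter_conj n a)" and ?r = "perm (rev (letter_conj n a))"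
  have "?q \<circ> transpose 1 2 = transpose (?q 1) (?q 2) \<circ> ?q"
    using bij_is_inj[OF bij_perm] by (auto simp: fun_eq_iff transpose_def inj_eq)
  then have "?q \<circ> transpose 1 2 \<circ> ?r = transpose (?q 1) (?q 2) \<circ> (?q \<circ> ?r)"
    by (simp only: o_assoc)
  moreover have "word_perm [SGen 1] = transpose 1 2"
    by (simp add: word_perm_def numeral_2_eq_2)
  ultimately show ?thesis
    unfolding letter_word_def conj_word_def word_perm_append word_perm_RGen
    using letter_conj[OF assms] by (simp only: o_assoc perm_comp_rev comp_id)
qed

text \<open>The element is \<open>[i,j] \<rho>\<^sub>i\<^sub>j\<close>; it is pure because both factors project to \<open>(i j)\<close>.\<close>
lemma twist_exists:
  assumes a: "(i, j) \<in> letters n"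
  obtains u where "set u \<subseteq> vt_gens n" "cls n u \<in> carrier (PVT n)"
    "\<And>v p. word_act u (v, p) = (pair.act (i, j) (relabel (transpose i j) v), transpose i j \<circ> p)"
proof -
  have "transpose i j permutes {1..n}"
    using a by (intro permutes_swap_id) (auto simp: letters_def)
  then obtain js where js: "set js \<subseteq> {1..<n}" "perm js = transpose i j" by (rule perm_exists)
  let ?u = "letter_word n (i, j) @ map RGen js"
  have u: "set ?u \<subseteq> vt_gens n" using letter_word_gens[OF a] js by auto
  have "word_perm ?u = id"
    by (simp only: word_perm_append word_perm_RGen word_perm_letter_word[OF a] js fst_conv snd_conv
        transpose_comp_involutory)
  then have "cls n ?u \<in> carrier (PVT n)"
    using u by (simp add: PVT_def kernel_def cls_closed vt_pi_cls sym_group_one)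
  moreover have "word_act ?u (v, p) = (pair.act (i, j) (relabel (transpose i j) v), transpose i j \<circ> p)" for v p
    by (simp only: word_act_append word_act_RGen word_act_letter_word[OF a] js)
  ultimately show ?thesis using that u by blast
qed

lemma third_index:
  assumes "3 \<le> n"
  obtains j :: nat where "j \<in> {1..n}" "j \<noteq> k" "j \<noteq> l"
proof -
  have "\<exists>j\<in>{1, 2, 3}. j \<noteq> k \<and> j \<noteq> l" by auto
  moreover have "{1, 2, 3} \<subseteq> {1..n}" using assms by auto
  ultimately show ?thesis using that by blast
qed

lemma permutes_commuting_transpositions:
  assumes p: "p permutes {1..n}" and n: "3 \<le> n"
    and comm: "\<And>i j. (i, j) \<in> letters n \<Longrightarrow> p \<circ> transpose i j = transpose i j \<circ> p"
  shows "p = id"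
proof
  fix x
  show "p x = id x"
  proof (rule ccontr)
    assume ne: "p x \<noteq> id x"
    then have x: "x \<in> {1..n}" using permutes_not_in[OF p] by (metis id_apply)
    then have y: "p x \<in> {1..n}" using permutes_in_image[OF p] by blast
    obtain k where k: "k \<in> {1..n}" "k \<noteq> x" "k \<noteq> p x" using n by (rule third_index)
    have "(p x, k) \<in> letters n" using y k by (auto simp: letters_def)
    from fun_cong[OF comm[OF this], of x] show False using ne k by (simp add: transpose_def)
  qed
qed

text \<open>A letter \<open>(k, l)\<close> of \<open>w\<close> is excluded by taking the transposition of \<open>k\<close> with a
  third index.\<close>
lemma twisted_commuting_imp_Nil:
  assumes n: "3 \<le> n" and w: "set w \<subseteq> letters n" "pair.reduced w"
    and comm: "\<And>i j. (i, j) \<in> letters n \<Longrightarrow>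
      pair.teq (pair.act (i, j) (relabel (transpose i j) w)) (foldr pair.act (w @ [(i, j)]) [])"
  shows "w = []"
proof (rule ccontr)
  assume "w \<noteq> []"
  then obtain k l where kl: "(k, l) \<in> set w" by (metis list.set_intros(1) neq_Nil_conv surj_pair)
  then have L: "k \<in> {1..n}" "l \<in> {1..n}" "k \<noteq> l" using w by (auto simp: letters_def)
  obtain j where j: "j \<in> {1..n}" "j \<noteq> k" "j \<noteq> l" using n by (rule third_index)
  \<comment> \<open>Any two of these four letters share an index, and the swap of \<open>k\<close> and \<open>j\<close> permutes them.\<close>
  let ?f = "map_prod (transpose k j) (transpose k j)"
  let ?C = "{(k, j), (j, k), (k, l), (j, l)}"
  interpret f: dependence_automorphism meets ?f by (rule transpose_automorphism)
  have f: "?f (k, j) = (j, k)" "?f (j, k) = (k, j)" by (simp_all)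
  have "set w \<inter> ?C \<subseteq> {(k, j), ?f (k, j)}"
  proof (rule f.twisted_commuting_word)
    show "pair.teq (pair.act (k, j) (relabel (transpose k j) w)) (foldr pair.act (w @ [(k, j)]) [])"
      using L j by (intro comm) (auto simp: letters_def)
    have "(j, k) \<in> letters n" using L j by (auto simp: letters_def)
    from comm[OF this]
    show "pair.teq (pair.act (?f (k, j)) (relabel (transpose k j) w)) (foldr pair.act (w @ [?f (k, j)]) [])"
      by (simp only: f transpose_commute[of j k])
    show "pair.clique ?C" by (auto simp: pair.clique_def meets_def)
    show "?f -` ?C = ?C"
      using L j by (auto simp: transpose_def split: if_splits)
  qed (use w j f in auto)
  then show False using kl L j by auto
qed

text \<open>The products \<open>t z\<close> and \<open>z t\<close>, with \<open>t = [i,j] \<rho>\<^sub>i\<^sub>j\<close>, act on the base point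
  \<open>([], id)\<close> in the same way; this yields one equation of permutations and one of words for every pair
  of indices.\<close>
lemma centralizer_PVT_trivial:
  assumes n: "3 \<le> n" and z: "z \<in> carrier (VT n)"
    and comm: "\<And>x. x \<in> carrier (PVT n) \<Longrightarrow> z \<otimes>\<^bsub>VT n\<^esub> x = x \<otimes>\<^bsub>VT n\<^esub> z"
  shows "z = \<one>\<^bsub>VT n\<^esub>"
proof -
  obtain u where u: "set u \<subseteq> vt_gens n" "z = cls n u" using z by (rule VT_carrier_cls)
  obtain w "is" where w: "set w \<subseteq> letters n" "pair.reduced w" and "is": "set is \<subseteq> {1..<n}"
    and nf: "cls n u = cls n (expand n w @ map RGen is)"
    using u(1) by (rule normal_form)
  let ?z = "expand n w @ map RGen is" and ?p = "perm is"
  have z': "z = cls n ?z" using u nf by simp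
  have gz: "set ?z \<subseteq> vt_gens n"
    using u(1) nf cls_empty_iff by metis
  have eq: "pair.teq (pair.act (i, j) (relabel (transpose i j) w)) (foldr pair.act w [map_prod ?p ?p (i, j)])
      \<and> ?p \<circ> transpose i j = transpose i j \<circ> ?p" if a: "(i, j) \<in> letters n" for i j
  proof -
    obtain t where t: "set t \<subseteq> vt_gens n" "cls n t \<in> carrier (PVT n)"
      "\<And>v p. word_act t (v, p) = (pair.act (i, j) (relabel (transpose i j) v), transpose i j \<circ> p)"
      using a by (rule twist_exists) blast
    have "cls n (t @ ?z) = cls n (?z @ t)"
      using comm[OF t(2)] unfolding z' cls_mult[OF gz t(1)] cls_mult[OF t(1) gz] by simp
    moreover have "set (t @ ?z) \<subseteq> vt_gens n" using t(1) gz by simp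
    ultimately have "state_eq (word_act (t @ ?z) ([], id)) (word_act (?z @ t) ([], id))"
      by (rule word_act_cls) simp
    moreover have "word_act (t @ ?z) ([], id)
        = (pair.act (i, j) (relabel (transpose i j) w), transpose i j \<circ> ?p)"
      using pair.foldr_act_reduced[OF w(2)]
      by (simp only: word_act_append t(3) word_act_RGen word_act_expand[OF w(1)] list.map comp_id)
    moreover have "word_act (?z @ t) ([], id)
        = (foldr pair.act w [map_prod ?p ?p (i, j)], ?p \<circ> transpose i j)"
      by (simp only: word_act_append t(3) word_act_RGen word_act_expand[OF w(1)] list.map comp_id
          pair.act_def pair.front.simps if_False)
    ultimately show ?thesis by (simp add: state_eq_def)
  qed
  have p: "?p = id"
    using perm_permutes[OF "is"] n by (rule permutes_commuting_transpositions) (use eq in blast)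
  have "w = []"
  proof (rule twisted_commuting_imp_Nil[OF n w])
    fix i j assume "(i, j) \<in> letters n"
    from eq[OF this] show "pair.teq (pair.act (i, j) (relabel (transpose i j) w)) (foldr pair.act (w @ [(i, j)]) [])"
      by (simp add: p pair.act_def)
  qed
  moreover have "rcls n is = rcls n []"
    using "is" by (rule coxeter_unique) (simp_all only: p, simp_all)
  ultimately show ?thesis by (simp add: z' cls_one)
qed

text \<open>For \<open>n = 2\<close> there is no third index, but \<open>VT\<^sub>2\<close> is an infinite dihedral group: the letters
  \<open>(1, 2)\<close> and \<open>(2, 1)\<close> form a clique and reduced words are unique as lists. Commuting with
  \<open>\<rho>\<^sub>1\<close> makes \<open>w\<close> empty, and commuting with \<open>s\<^sub>1\<close> then excludes \<open>z = \<rho>\<^sub>1\<close>.\<close>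
lemma center_VT2_trivial:
  assumes z: "z \<in> carrier (VT 2)"
    and comm: "\<And>x. x \<in> carrier (VT 2) \<Longrightarrow> z \<otimes>\<^bsub>VT 2\<^esub> x = x \<otimes>\<^bsub>VT 2\<^esub> z"
  shows "z = \<one>\<^bsub>VT 2\<^esub>"
proof -
  obtain u where u: "set u \<subseteq> vt_gens 2" "z = cls 2 u" using z by (rule VT_carrier_cls)
  obtain w "is" where w: "set w \<subseteq> letters 2" "pair.reduced w" and "is": "set is \<subseteq> {1..<2}"
    and nf: "cls 2 u = cls 2 (expand 2 w @ map RGen is)"
    using u(1) by (rule normal_form)
  let ?z = "expand 2 w @ map RGen is" and ?p = "perm is"
  have z': "z = cls 2 ?z" using u nf by simp
  have gz: "set ?z \<subseteq> vt_gens 2"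
    using u(1) nf cls_empty_iff by metis
  have eq: "state_eq (word_act (t @ ?z) ([], id)) (word_act (?z @ t) ([], id))"
    if t: "set t \<subseteq> vt_gens 2" for t
  proof (rule word_act_cls)
    show "cls 2 (t @ ?z) = cls 2 (?z @ t)"
      using comm[OF cls_closed[OF t]] unfolding z' cls_mult[OF gz t] cls_mult[OF t gz] by simp
  qed (use t gz in simp_all)
  have L: "letters 2 = {(1, 2), (2, 1)}" by (auto simp: letters_def)
  have C: "pair.clique (letters 2)" unfolding L by (auto simp: pair.clique_def meets_def)
  have "pair.teq (relabel (transpose 1 2) w) w"
    using eq[of "[RGen 1]"] pair.foldr_act_reduced[OF w(2)]
    by (simp add: state_eq_def word_act_RGen word_act_expand[OF w(1), unfolded numeral_2_eq_2] numeral_2_eq_2)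
  then have "filter (\<lambda>c. c \<in> letters 2) (relabel (transpose 1 2) w) = filter (\<lambda>c. c \<in> letters 2) w"
    using C by (rule pair.teq_filter)
  moreover have "filter (\<lambda>c. c \<in> letters 2) v = v" if "set v \<subseteq> letters 2" for v
    using that by (auto simp: filter_id_conv)
  moreover have "set (relabel (transpose 1 2) w) \<subseteq> letters 2" using w(1) unfolding L by auto
  ultimately have fixed: "relabel (transpose 1 2) w = w" using w(1) by metis
  have [simp]: "w = []"
  proof (cases w)
    case (Cons a v)
    then show ?thesis using fixed w(1) unfolding L by auto
  qed
  have "pair.teq [(1, 2)] [(?p 1, ?p 2)]"
    using eq[of "[SGen 1]"] by (simp add: state_eq_def word_act_RGen pair.act_def numeral_2_eq_2)
  from pair.teq_filter[OF this pair.clique_pair[OF pair.D_refl], of "(1, 2)"]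
  have "?p 1 = 1" "?p 2 = 2" by (auto split: if_splits)
  moreover have "?p permutes {1..2}" using "is" by (rule perm_permutes)
  moreover have "{1..2} = {1, 2::nat}" by auto
  ultimately have "?p x = x" for x by (cases "x \<in> {1, 2}") (auto simp: permutes_not_in)
  then have p: "?p = id" by auto
  have "rcls 2 is = rcls 2 []"
    using "is" by (rule coxeter_unique) (simp_all only: p, simp_all)
  then show ?thesis by (simp add: z' cls_one)
qed

theorem corollary4p2:
  shows "(\<forall>n\<ge>3. group_center (PVT n) = {\<one>\<^bsub>PVT n\<^esub>}) \<and>
         (\<forall>n\<ge>2. group_center (VT n) = {\<one>\<^bsub>VT n\<^esub>})"
proof (intro conjI allI impI)
  have sub: "carrier (PVT n) \<subseteq> carrier (VT n)" for n
    by (auto simp: PVT_def kernel_def)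
  have center: "group_center G = {\<one>\<^bsub>G\<^esub>}"
    if "group G" "\<And>z. z \<in> group_center G \<Longrightarrow> z = \<one>\<^bsub>G\<^esub>" for G :: "'a monoid"
  proof -
    interpret group G by fact
    have "\<one>\<^bsub>G\<^esub> \<in> group_center G" by (simp add: group_center_def)
    then show ?thesis using that(2) by blast
  qed
  have PVT: "x \<otimes>\<^bsub>PVT n\<^esub> y = x \<otimes>\<^bsub>VT n\<^esub> y" "\<one>\<^bsub>PVT n\<^esub> = \<one>\<^bsub>VT n\<^esub>" for n x y
    by (simp_all add: PVT_def)
  fix n :: nat
  show "group_center (PVT n) = {\<one>\<^bsub>PVT n\<^esub>}" if n: "3 \<le> n"
    using group_PVT
  proof (rule center)
    fix z assume "z \<in> group_center (PVT n)"
    then show "z = \<one>\<^bsub>PVT n\<^esub>"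
      unfolding group_center_def PVT using sub[of n] by (intro centralizer_PVT_trivial[OF n]) auto
  qed
  show "group_center (VT n) = {\<one>\<^bsub>VT n\<^esub>}" if n: "2 \<le> n"
    using group_VT
  proof (rule center)
    fix z assume "z \<in> group_center (VT n)"
    then have z: "z \<in> carrier (VT n)"
      and comm: "\<And>x. x \<in> carrier (VT n) \<Longrightarrow> z \<otimes>\<^bsub>VT n\<^esub> x = x \<otimes>\<^bsub>VT n\<^esub> z"
      by (auto simp: group_center_def)
    show "z = \<one>\<^bsub>VT n\<^esub>"
    proof (cases "n = 2")
      case True
      then show ?thesis using center_VT2_trivial z comm by simp
    next
      case False
      then show ?thesis using centralizer_PVT_trivial[of n z] n z comm sub by auto
    qed
  qed
qed

end
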